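(* For $(\tilde t,q)\in\tilde D$, $$-(\tilde t-q)\log4+\log\zeta(2\tilde t-2q)\le P_1(\tilde t,q)\le\log\zeta(2\tilde t-2q).$$ Moreover: (1) for any point $(\tilde t_0,q_0)$ on the line $\tilde t-q=1/2$, $\lim_{(\tilde t,q)\to(\tilde t_0,q_0),\,(\tilde t,q)\in\tilde D}P_1(\tilde t,q)=\infty$; (2) for fixed $\tilde t\in\mathbb{R}$, $\lim_{q\to(\tilde t-\frac12)^-}\frac{\partial P_1}{\partial q}(\tilde t,q)=+\infty$; (3) with $\gamma_0=2\log\frac{1+\sqrt5}2$, for fixed $\tilde t\in\mathbb{R}$, $\lim_{q\to-\infty}\frac{P_1(\tilde t,q)}q=\gamma_0$ and $\lim_{q\to-\infty}\frac{\partial P_1}{\partial q}(\tilde t,q)=\gamma_0$.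
   Context: $\tilde D=\{(\tilde t,q)\in\mathbb{R}^2:\tilde t-q>1/2\}$; $\zeta(s)=\sum_{n\ge1}n^{-s}$ for $s>1$. Write $[\omega_1,\dots,\omega_n+x]=\cfrac{1}{\omega_1+\cfrac{1}{\ddots+\cfrac{1}{\omega_n+x}}}$. For $(\tilde t,q)\in\tilde D$, $$P_1(\tilde t,q)=\lim_{n\to\infty}\frac1n\log\sum_{\omega_1=1}^\infty\cdots\sum_{\omega_n=1}^\infty\exp\Big(\sup_{x\in[0,1]}\log\prod_{j=1}^n([\omega_j,\dots,\omega_n+x])^{2(\tilde t-q)}\Big),$$ a real-analytic function on $\tilde D$. *)

theory Defs
  imports "HOL-Analysis.Analysis"
begin

definition Dtilde :: "(real \<times> real) set" where
  "Dtilde = {(t, q). t - q > 1/2}"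

(* Only meaningful for s > 1; HOL-Analysis has no zeta function. *)
definition zeta :: "real \<Rightarrow> real" where
  "zeta s = (\<Sum>\<^sub>\<infinity>n\<in>{1::nat..}. real n powr (- s))"

(* cfrac [w1, ..., wn] x is the finite continued fraction [w1, ..., wn + x]; the empty list
   returns x itself, so that the innermost level is 1 / (wn + x). *)
fun cfrac :: "nat list \<Rightarrow> real \<Rightarrow> real" where
  "cfrac [] x = x"
| "cfrac (w # ws) x = 1 / (real w + cfrac ws x)"

(* iter_sum n F is the iterated series of F [w1, ..., wn] over w1, ..., wn >= 1, with the sum
   over w1 outermost. *)
fun iter_sum :: "nat \<Rightarrow> (nat list \<Rightarrow> real) \<Rightarrow> real" where
  "iter_sum 0 F = F []"
| "iter_sum (Suc n) F = (\<Sum>\<^sub>\<infinity>w\<in>{1::nat..}. iter_sum n (\<lambda>ws. F (w # ws)))"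

(* With ws = [w1, ..., wn], drop j ws is [w(j+1), ..., wn]; the paper's j = 1, ..., n is
   shifted to j = 0, ..., n - 1. *)
definition partition_sum :: "nat \<Rightarrow> real \<Rightarrow> real \<Rightarrow> real" where
  "partition_sum n t q =
     iter_sum n (\<lambda>ws. exp (SUP x\<in>{0..1::real}.
       ln (\<Prod>j<n. cfrac (drop j ws) x powr (2 * (t - q)))))"

(* Only meaningful for (t, q) in Dtilde, where all series converge and the limit exists. *)
definition P1 :: "real \<Rightarrow> real \<Rightarrow> real" where
  "P1 t q = lim (\<lambda>n. (1 / real n) * ln (partition_sum n t q))"

definition gamma0 :: real where
  "gamma0 = 2 * ln ((1 + sqrt 5) / 2)"

end

theory Submission
  imports Defs "HOL-Real_Asymp.Real_Asymp"
begin

text \<open>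
  Put \<open>s = 2 * (t - q)\<close>. The supremum is attained at \<open>x = 0\<close>, so the partition sums are
  \<open>Z n s = \<Sum> K(w) powr (- s)\<close> over words \<open>w\<close> of length \<open>n\<close>, with \<open>K\<close> the continuant. From
  \<open>K u * K v \<le> K (u @ v) \<le> 2 * K u * K v\<close> one gets \<open>n * P s \<le> ln (Z n s) \<le> n * P s + s * ln 2\<close>,
  where \<open>P\<close> is convex; \<open>n = 1\<close> gives the bounds, hence (1), and comparing \<open>K\<close> with powers of
  the golden ratio gives \<open>P s / s \<longlonglongrightarrow> - ln golden\<close>. The derivative limits then follow from
  convexity, once \<open>P\<close> is known to be differentiable.

  For differentiability no spectral theory is needed. Average \<open>K (block of length n) powr (- 2 * \<tau> / n)\<close>
  over all rotations of a long word. By AM-GM and supermultiplicativity this average decreases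
  when \<open>n\<close> is doubled, by at least half the mean squared difference of \<open>K powr (- \<tau> / n)\<close> between
  adjacent blocks. Summing over the scales \<open>n = 2 ^ k\<close> bounds the sum of these mean squares, and
  since adjacent blocks are independent up to constants, the variance of \<open>K powr (- \<tau> / n)\<close> under
  the weights \<open>K powr (- s)\<close> tends to 0 along \<open>n = 2 ^ k\<close>. Hence eventually
  \<open>Z n (s + \<tau> / n) * Z n (s - \<tau> / n) \<le> 2 * (Z n s)^2\<close>, whereas a kink of \<open>P\<close> at \<open>s\<close> would make
  the ratio of the two sides grow exponentially in \<open>\<tau>\<close>.
\<close>

section \<open>Continuants\<close>

definition words :: "nat \<Rightarrow> nat list set" where
  "words n = {ws. length ws = n \<and> set ws \<subseteq> {1..}}"

text \<open>In the usual notation \<open>den ws x\<close> is \<open>q\<^sub>n + x * q\<^sub>n\<^sub>-\<^sub>1\<close>, the reciprocal of the product of the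
  continued fractions of all suffixes of \<open>ws\<close>.\<close>

primrec den :: "nat list \<Rightarrow> real \<Rightarrow> real" where
  "den [] x = 1"
| "den (w # ws) x = den ws x * (real w + cfrac ws x)"

abbreviation cont :: "nat list \<Rightarrow> real" where
  "cont ws \<equiv> den ws 0"

lemma words_0 [simp]: "words 0 = {[]}"
  by (auto simp: words_def)

lemma append_in_words: "us \<in> words m \<Longrightarrow> vs \<in> words n \<Longrightarrow> us @ vs \<in> words (m + n)"
  by (auto simp: words_def)

lemma rotate_in_words_iff [simp]: "rotate i ws \<in> words n \<longleftrightarrow> ws \<in> words n"
  by (auto simp: words_def)

lemma take_in_words: "ws \<in> words n \<Longrightarrow> m \<le> n \<Longrightarrow> take m ws \<in> words m"
  using set_take_subset[of m ws] by (auto simp: words_def)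

lemma drop_in_words: "ws \<in> words n \<Longrightarrow> drop m ws \<in> words (n - m)"
  using set_drop_subset[of m ws] by (auto simp: words_def)

lemma bij_betw_append_words:
  "bij_betw (\<lambda>(us, vs). us @ vs) (words m \<times> words n) (words (m + n))"
proof (rule bij_betwI[where g = "\<lambda>ws. (take m ws, drop m ws)"])
  show "(\<lambda>(us, vs). us @ vs) \<in> words m \<times> words n \<rightarrow> words (m + n)"
    by (auto intro: append_in_words)
  show "(\<lambda>ws. (take m ws, drop m ws)) \<in> words (m + n) \<rightarrow> words m \<times> words n"
    using take_in_words[of _ "m + n" m] drop_in_words[of _ "m + n" m] by auto
qed (auto simp: words_def)

lemma bij_betw_Cons_words:
  "bij_betw (\<lambda>(w, ws). w # ws) ({1..} \<times> words n) (words (Suc n))"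
  by (rule bij_betwI[where g = "\<lambda>ws. (hd ws, tl ws)"])
     (auto simp: words_def length_Suc_conv)

lemma bij_betw_rotate_words: "bij_betw (rotate i) (words n) (words n)"
proof (rule bij_betwI[where g = "rotate (n - i mod n)"])
  have dvd: "n dvd (n - i mod n) + i" if "n > 0"
  proof -
    have "(n - i mod n) + i = n + n * (i div n)"
      using mod_less_divisor[OF that, of i] mult_div_mod_eq[of n i] by linarith
    thus ?thesis by simp
  qed
  show "rotate (n - i mod n) (rotate i ws) = ws" "rotate i (rotate (n - i mod n) ws) = ws"
    if "ws \<in> words n" for ws
    using that dvd by (cases "n = 0"; simp add: rotate_rotate words_def add.commute)+
qed auto

lemma cfrac_append: "cfrac (us @ vs) x = cfrac us (cfrac vs x)"
  by (induction us) auto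

lemma den_append: "den (us @ vs) x = den vs x * den us (cfrac vs x)"
  by (induction us) (auto simp: cfrac_append)

lemma cfrac_nonneg: "x \<ge> 0 \<Longrightarrow> cfrac ws x \<ge> 0"
  by (induction ws) auto

lemma cfrac_le_1:
  assumes "set ws \<subseteq> {1..}" "x \<in> {0..1}"
  shows "cfrac ws x \<le> 1"
  using assms cfrac_nonneg[of x "tl ws"] by (cases ws) (auto simp: divide_le_eq)

lemma den_Cons_Cons:
  assumes "v \<ge> 1" "x \<ge> 0"
  shows "den (w # v # vs) x = real w * den (v # vs) x + den vs x"
proof -
  have "real v + cfrac vs x > 0"
    using assms cfrac_nonneg[of x vs] by linarith
  thus ?thesis by (simp add: field_simps)
qed

lemma den_Cons_ge:
  assumes "x \<ge> 0" "den ws x \<ge> 0"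
  shows "den (w # ws) x \<ge> real w * den ws x"
  using assms cfrac_nonneg[of x ws] by (simp add: distrib_left mult.commute)

lemma den_ge_1:
  assumes "set ws \<subseteq> {1..}" "x \<ge> 0"
  shows "den ws x \<ge> 1"
  using assms
proof (induction ws)
  case (Cons w ws)
  hence "1 * 1 \<le> real w * den ws x"
    by (intro mult_mono) auto
  also have "\<dots> \<le> den (w # ws) x"
    by (rule den_Cons_ge) (use Cons in auto)
  finally show ?case by simp
qed auto

lemma den_ge_cont:
  assumes "set ws \<subseteq> {1..}" "x \<ge> 0"
  shows "cont ws \<le> den ws x"
  using assms
proof (induction ws rule: induct_list012)
  case (3 w v vs)
  hence "real w * cont (v # vs) + cont vs \<le> real w * den (v # vs) x + den vs x"
    by (intro add_mono mult_left_mono) auto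
  thus ?case
    using den_Cons_Cons[of v 0 w vs] den_Cons_Cons[of v x w vs] 3(3,4) by (simp del: den.simps)
qed auto

lemma den_le_cont:
  assumes "set ws \<subseteq> {1..}" "x \<in> {0..1}"
  shows "den ws x \<le> 2 * cont ws"
  using assms
proof (induction ws rule: induct_list012)
  case (3 w v vs)
  hence "real w * den (v # vs) x + den vs x \<le> real w * (2 * cont (v # vs)) + 2 * cont vs"
    by (intro add_mono mult_left_mono) auto
  thus ?case
    using den_Cons_Cons[of v 0 w vs] den_Cons_Cons[of v x w vs] 3(3,4)
    by (simp add: algebra_simps del: den.simps)
qed auto

lemma cont_append_ge:
  assumes "set us \<subseteq> {1..}" "set vs \<subseteq> {1..}"
  shows "cont us * cont vs \<le> cont (us @ vs)"
  using assms den_ge_cont[of us "cfrac vs 0"] den_ge_1[of vs 0] cfrac_nonneg[of 0 vs]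
  by (simp add: den_append mult.commute)

lemma cont_append_le:
  assumes "set us \<subseteq> {1..}" "set vs \<subseteq> {1..}"
  shows "cont (us @ vs) \<le> 2 * cont us * cont vs"
  using assms den_le_cont[of us "cfrac vs 0"] den_ge_1[of vs 0] cfrac_nonneg[of 0 vs]
    cfrac_le_1[of vs 0]
  by (simp add: den_append mult.commute)

lemma cont_rotate_le:
  assumes "set ws \<subseteq> {1..}"
  shows "cont ws \<le> 2 * cont (rotate i ws)"
proof -
  define k where "k = i mod length ws"
  have sub: "set (take k ws) \<subseteq> {1..}" "set (drop k ws) \<subseteq> {1..}"
    using assms set_take_subset[of k ws] set_drop_subset[of k ws] by auto
  have "cont ws \<le> 2 * cont (take k ws) * cont (drop k ws)"
    using cont_append_le[OF sub] by simp
  also have "\<dots> \<le> 2 * cont (drop k ws @ take k ws)"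
    using cont_append_ge[OF sub(2,1)] by (simp add: mult_ac)
  also have "drop k ws @ take k ws = rotate i ws"
    by (simp add: rotate_drop_take k_def)
  finally show ?thesis .
qed

lemma prod_cfrac_powr:
  assumes "set ws \<subseteq> {1..}" "x \<ge> 0"
  shows "(\<Prod>j<length ws. cfrac (drop j ws) x powr s) = den ws x powr (- s)"
  using assms
proof (induction ws)
  case (Cons w ws)
  have pos: "den ws x > 0" "real w + cfrac ws x > 0"
    using Cons.prems den_ge_1[of ws x] cfrac_nonneg[of x ws] by auto
  have "(\<Prod>j<length (w # ws). cfrac (drop j (w # ws)) x powr s) =
        cfrac (w # ws) x powr s * (\<Prod>j<length ws. cfrac (drop j ws) x powr s)"
    by (simp only: length_Cons prod.lessThan_Suc_shift) (simp add: mult.commute)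
  also have "\<dots> = (real w + cfrac ws x) powr (- s) * den ws x powr (- s)"
    using Cons pos by (simp add: powr_divide powr_minus_divide)
  finally show ?case using pos by (simp add: powr_mult mult.commute)
qed auto

lemma sup_prod_cfrac:
  assumes "ws \<in> words n" "s \<ge> 0"
  shows "exp (SUP x\<in>{0..1::real}. ln (\<Prod>j<n. cfrac (drop j ws) x powr s)) = cont ws powr (- s)"
proof -
  have ws: "set ws \<subseteq> {1..}" "length ws = n" using assms by (auto simp: words_def)
  have eq: "ln (\<Prod>j<n. cfrac (drop j ws) x powr s) = - s * ln (den ws x)" if "x \<in> {0..1}" for x
    using prod_cfrac_powr[of ws x s] den_ge_1[of ws x] ws that by (simp add: ln_powr)
  have "(SUP x\<in>{0..1::real}. ln (\<Prod>j<n. cfrac (drop j ws) x powr s)) = - s * ln (cont ws)"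
  proof (rule cSup_eq_maximum)
    show "- s * ln (cont ws) \<in> (\<lambda>x. ln (\<Prod>j<n. cfrac (drop j ws) x powr s)) ` {0..1}"
      using eq[of 0] by (force intro!: image_eqI[where x = 0])
  next
    fix y assume "y \<in> (\<lambda>x. ln (\<Prod>j<n. cfrac (drop j ws) x powr s)) ` {0..1}"
    then obtain x where x: "x \<in> {0..1}" "y = - s * ln (den ws x)" using eq by auto
    have "ln (cont ws) \<le> ln (den ws x)"
      using den_ge_cont[of ws x] den_ge_1[of ws 0] ws x by simp
    thus "y \<le> - s * ln (cont ws)"
      using x assms(2) by (simp add: mult_left_mono)
  qed
  thus ?thesis using den_ge_1[of ws 0] ws by (simp add: powr_def)
qed

section \<open>Partition sums\<close>

lemma has_sum_product_real:
  fixes f :: "'a \<Rightarrow> real" and g :: "'b \<Rightarrow> real"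
  assumes "(f has_sum a) A" "(g has_sum b) B"
    and "\<And>x. x \<in> A \<Longrightarrow> f x \<ge> 0" "\<And>y. y \<in> B \<Longrightarrow> g y \<ge> 0"
  shows "((\<lambda>(x, y). f x * g y) has_sum a * b) (A \<times> B)"
proof (rule has_sum_SigmaI)
  show "((\<lambda>y. case (x, y) of (x, y) \<Rightarrow> f x * g y) has_sum f x * b) B" for x
    using has_sum_cmult_right[OF assms(2), of "f x"] by simp
  show "((\<lambda>x. f x * b) has_sum a * b) A"
    using has_sum_cmult_left[OF assms(1)] by simp
  show "(\<lambda>(x, y). f x * g y) summable_on A \<times> B"
    by (rule summable_on_SigmaI[where g = "\<lambda>x. f x * b"])
       (use assms in \<open>auto intro!: has_sum_cmult_right has_sum_imp_summable[OF has_sum_cmult_left]\<close>)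
qed

lemma iter_sum_eq_infsum:
  assumes "F summable_on words n"
  shows "iter_sum n F = infsum F (words n)"
  using assms
proof (induction n arbitrary: F)
  case (Suc n)
  have sm: "(\<lambda>(w, ws). F (w # ws)) summable_on {1..} \<times> words n"
    using Suc.prems summable_on_reindex_bij_betw[OF bij_betw_Cons_words, of F n]
    by (simp add: case_prod_unfold)
  have "iter_sum (Suc n) F = (\<Sum>\<^sub>\<infinity>w\<in>{1..}. \<Sum>\<^sub>\<infinity>ws\<in>words n. F (w # ws))"
    unfolding iter_sum.simps
    by (intro infsum_cong Suc.IH) (use summable_on_SigmaD1[OF sm] in auto)
  also have "\<dots> = (\<Sum>\<^sub>\<infinity>(w, ws)\<in>{1..} \<times> words n. F (w # ws))"
    by (rule infsum_Sigma'_banach) (use sm in auto)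
  also have "\<dots> = infsum F (words (Suc n))"
    using infsum_reindex_bij_betw[OF bij_betw_Cons_words, of F n] by (simp add: case_prod_unfold)
  finally show ?case .
qed auto

lemma zeta_has_sum:
  assumes "s > 1"
  shows "((\<lambda>n. real n powr (- s)) has_sum zeta s) {1..}"
proof -
  have "summable (\<lambda>n. real n powr (- s))"
    using assms by (simp add: summable_real_powr_iff)
  hence "(\<lambda>n. real n powr (- s)) summable_on UNIV"
    by (rule summable_nonneg_imp_summable_on) auto
  hence "(\<lambda>n. real n powr (- s)) summable_on {1..}"
    by (rule summable_on_subset) auto
  thus ?thesis by (simp add: zeta_def)
qed

lemma cont_ge_1: "ws \<in> words n \<Longrightarrow> cont ws \<ge> 1"
  by (intro den_ge_1) (auto simp: words_def)

lemma summable_cont_powr: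
  assumes "s > 1"
  shows "(\<lambda>ws. cont ws powr (- s)) summable_on words n"
proof (induction n)
  case (Suc n)
  have sm: "(\<lambda>(w, ws). real w powr (- s) * cont ws powr (- s)) summable_on {1..} \<times> words n"
    using has_sum_product_real[OF zeta_has_sum[OF assms] has_sum_infsum[OF Suc]]
    by (auto simp: summable_on_def)
  have "(\<lambda>(w, ws). cont (w # ws) powr (- s)) summable_on {1..} \<times> words n"
  proof (rule summable_on_comparison_test[OF sm], goal_cases)
    case (1 p)
    obtain w ws where p: "p = (w, ws)" "w \<ge> 1" "ws \<in> words n" using 1 by auto
    have c: "cont ws \<ge> 1" using p cont_ge_1 by auto
    have "cont (w # ws) powr (- s) \<le> (real w * cont ws) powr (- s)"
      using p c den_Cons_ge[of 0 ws w] assms by (intro powr_mono2') auto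
    thus ?case using p c by (simp add: powr_mult)
  qed auto
  thus ?case
    using summable_on_reindex_bij_betw[OF bij_betw_Cons_words, of "\<lambda>ws. cont ws powr (- s)" n]
    by (simp add: case_prod_unfold)
qed auto

definition wsum :: "nat \<Rightarrow> real \<Rightarrow> real" where
  "wsum n s = (\<Sum>\<^sub>\<infinity>ws\<in>words n. cont ws powr (- s))"

lemma has_sum_wsum: "s > 1 \<Longrightarrow> ((\<lambda>ws. cont ws powr (- s)) has_sum wsum n s) (words n)"
  unfolding wsum_def by (intro has_sum_infsum summable_cont_powr)

lemma partition_sum_eq_wsum:
  assumes "2 * (t - q) > 1"
  shows "partition_sum n t q = wsum n (2 * (t - q))"
proof -
  let ?F = "\<lambda>ws. exp (SUP x\<in>{0..1::real}. ln (\<Prod>j<n. cfrac (drop j ws) x powr (2 * (t - q))))"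
  have eq: "?F ws = cont ws powr (- (2 * (t - q)))" if "ws \<in> words n" for ws
    using sup_prod_cfrac[OF that] assms by simp
  have "?F summable_on words n"
    using summable_cont_powr[OF assms] summable_on_cong[of "words n" ?F, OF eq] by simp
  hence "partition_sum n t q = infsum ?F (words n)"
    unfolding partition_sum_def by (rule iter_sum_eq_infsum)
  also have "\<dots> = wsum n (2 * (t - q))"
    unfolding wsum_def by (rule infsum_cong) (rule eq)
  finally show ?thesis .
qed

lemma wsum_0 [simp]: "wsum 0 s = 1"
  by (simp add: wsum_def)

lemma wsum_1:
  assumes "s > 1"
  shows "wsum 1 s = zeta s"
proof -
  have "((\<lambda>w. cont [w] powr (- s)) has_sum zeta s) {1..}"
    using zeta_has_sum[OF assms] by simp
  also have "?this \<longleftrightarrow> ((\<lambda>ws. cont ws powr (- s)) has_sum zeta s) (words 1)"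
    by (rule has_sum_reindex_bij_witness[where i = hd and j = "\<lambda>w. [w]"])
       (auto simp: words_def length_Suc_conv)
  finally show ?thesis unfolding wsum_def by (rule infsumI)
qed

lemma wsum_ge_term:
  assumes "s > 1" "ws \<in> words n"
  shows "cont ws powr (- s) \<le> wsum n s"
  using finite_sum_le_has_sum[OF has_sum_wsum[OF assms(1)], of "{ws}" n] assms by auto

lemma wsum_pos:
  assumes "s > 1"
  shows "wsum n s > 0"
proof -
  have w: "replicate n 1 \<in> words n" by (auto simp: words_def)
  have "0 < cont (replicate n 1) powr (- s)" using cont_ge_1[OF w] by simp
  also have "\<dots> \<le> wsum n s" by (rule wsum_ge_term[OF assms w])
  finally show ?thesis .
qed

lemma wsum_product_has_sum:
  assumes "s > 1"
  shows "((\<lambda>(us, vs). cont us powr (- s) * cont vs powr (- s)) has_sum wsum m s * wsum n s)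
    (words m \<times> words n)"
  by (intro has_sum_product_real has_sum_wsum assms) auto

lemma wsum_append_has_sum:
  assumes "s > 1"
  shows "((\<lambda>(us, vs). cont (us @ vs) powr (- s)) has_sum wsum (m + n) s) (words m \<times> words n)"
  using has_sum_wsum[OF assms, of "m + n"]
    has_sum_reindex_bij_betw[OF bij_betw_append_words, of "\<lambda>ws. cont ws powr (- s)" m n]
  by (simp add: case_prod_unfold)

lemma wsum_add_le:
  assumes "s > 1"
  shows "wsum (m + n) s \<le> wsum m s * wsum n s"
proof (rule has_sum_mono[OF wsum_append_has_sum[OF assms] wsum_product_has_sum[OF assms]], safe)
  fix us vs assume w: "us \<in> words m" "vs \<in> words n"
  have c: "cont us \<ge> 1" "cont vs \<ge> 1" using cont_ge_1 w by auto
  have "cont (us @ vs) powr (- s) \<le> (cont us * cont vs) powr (- s)"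
    using w c cont_append_ge[of us vs] assms
    by (intro powr_mono2') (auto simp: words_def intro: mult_pos_pos)
  thus "cont (us @ vs) powr (- s) \<le> cont us powr (- s) * cont vs powr (- s)"
    using c by (simp add: powr_mult)
qed

lemma cont_append_powr_ge:
  assumes "s \<ge> 0" "us \<in> words m" "vs \<in> words n"
  shows "2 powr (- s) * (cont us powr (- s) * cont vs powr (- s)) \<le> cont (us @ vs) powr (- s)"
proof -
  have c: "cont us \<ge> 1" "cont vs \<ge> 1" "cont (us @ vs) \<ge> 1"
    using cont_ge_1 append_in_words assms by blast+
  have "(2 * cont us * cont vs) powr (- s) \<le> cont (us @ vs) powr (- s)"
    using assms c cont_append_le[of us vs]
    by (intro powr_mono2') (auto simp: words_def)
  thus ?thesis using c by (simp add: powr_mult mult.assoc)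
qed

lemma wsum_add_ge:
  assumes "s > 1"
  shows "2 powr (- s) * (wsum m s * wsum n s) \<le> wsum (m + n) s"
  by (rule has_sum_mono[OF has_sum_cmult_right[OF wsum_product_has_sum[OF assms]]
        wsum_append_has_sum[OF assms]])
     (use assms cont_append_powr_ge in auto)

section \<open>Pressure\<close>

lemma almost_additive_limit:
  fixes a :: "nat \<Rightarrow> real"
  assumes a0: "a 0 = 0"
    and le: "\<And>m n. a (m + n) \<le> a m + a n"
    and ge: "\<And>m n. a m + a n - c \<le> a (m + n)"
  obtains L where "(\<lambda>n. a n / n) \<longlonglongrightarrow> L"
    and "\<And>n. n * L \<le> a n" and "\<And>n. a n \<le> n * L + c"
proof -
  have c: "c \<ge> 0" using le[of 0 0] ge[of 0 0] by simp
  have mult_le: "a (m * n) \<le> m * a n" for m n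
  proof (induction m)
    case (Suc m)
    thus ?case using le[of n "m * n"] by (simp add: algebra_simps)
  qed (simp add: a0)
  have mult_ge: "m * a n - m * c \<le> a (m * n)" for m n
  proof (induction m)
    case (Suc m)
    thus ?case using ge[of n "m * n"] by (simp add: algebra_simps)
  qed (simp add: a0)
  have compare: "a n / n - c / n \<le> a m / m" if "m > 0" "n > 0" for m n
  proof -
    have "m * a n - m * c \<le> n * a m"
      using mult_ge[of m n] mult_le[of n m] by (simp add: mult.commute)
    thus ?thesis using that by (simp add: field_simps)
  qed
  have "Cauchy (\<lambda>n. a n / n)"
  proof (rule metric_CauchyI)
    fix e :: real assume e: "e > 0"
    obtain M :: nat where "max 1 (c / e) < M"
      using reals_Archimedean2 by blast
    hence M: "M > 0" "c / e < M" by (auto simp: max_less_iff_conj)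
    have small: "c / n < e" if "n \<ge> M" for n :: nat
    proof -
      have "c / e < n" using M that by linarith
      thus ?thesis using e M that by (simp add: field_simps)
    qed
    show "\<exists>M. \<forall>m\<ge>M. \<forall>n\<ge>M. dist (a m / m) (a n / n) < e"
    proof (intro exI[of _ M] allI impI)
      fix m n assume mn: "m \<ge> M" "n \<ge> M"
      thus "dist (a m / m) (a n / n) < e"
        using compare[of m n] compare[of n m] small[of m] small[of n] M
        by (simp add: dist_real_def abs_if)
    qed
  qed
  then obtain L where L: "(\<lambda>n. a n / n) \<longlonglongrightarrow> L"
    using Cauchy_convergent convergent_def by blast
  show ?thesis
  proof (rule that[OF L])
    fix n :: nat
    show "n * L \<le> a n"
    proof (cases "n = 0")
      case False
      have "(\<lambda>m. c / real m) \<longlonglongrightarrow> 0"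
        using tendsto_mult[OF tendsto_const[of c] lim_1_over_n] by simp
      hence "(\<lambda>m. a m / m - c / m) \<longlonglongrightarrow> L - 0"
        by (intro tendsto_diff L)
      moreover have "eventually (\<lambda>m. a m / m - c / m \<le> a n / n) sequentially"
        using eventually_gt_at_top[of 0] by eventually_elim (use compare False in auto)
      ultimately have "L - 0 \<le> a n / n"
        by (intro tendsto_upperbound) auto
      thus ?thesis using False by (simp add: field_simps)
    qed (simp add: a0)
    show "a n \<le> n * L + c"
    proof (cases "n = 0")
      case False
      have "eventually (\<lambda>m. a n / n - c / n \<le> a m / m) sequentially"
        using eventually_gt_at_top[of 0] by eventually_elim (use compare False in auto)
      with L have "a n / n - c / n \<le> L"
        by (intro tendsto_lowerbound) auto
      thus ?thesis using False by (simp add: field_simps)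
    qed (simp add: a0 c)
  qed
qed

definition pres :: "real \<Rightarrow> real" where
  "pres s = lim (\<lambda>n. ln (wsum n s) / n)"

lemma
  assumes s: "s > 1"
  shows pres_tendsto: "(\<lambda>n. ln (wsum n s) / n) \<longlonglongrightarrow> pres s"
    and pres_le: "n * pres s \<le> ln (wsum n s)"
    and pres_ge: "ln (wsum n s) \<le> n * pres s + s * ln 2"
proof -
  have le: "ln (wsum (m + n) s) \<le> ln (wsum m s) + ln (wsum n s)" for m n
    using wsum_add_le[OF s, of m n] wsum_pos[OF s] by (simp flip: ln_mult_pos)
  have ge: "ln (wsum m s) + ln (wsum n s) - s * ln 2 \<le> ln (wsum (m + n) s)" for m n
  proof -
    have "ln (2 powr (- s) * (wsum m s * wsum n s)) \<le> ln (wsum (m + n) s)"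
      using wsum_add_ge[OF s, of m n] wsum_pos[OF s] by simp
    thus ?thesis using wsum_pos[OF s, of m] wsum_pos[OF s, of n]
      by (simp add: ln_mult_pos ln_powr)
  qed
  obtain L where L: "(\<lambda>n. ln (wsum n s) / n) \<longlonglongrightarrow> L"
    "\<And>n. n * L \<le> ln (wsum n s)" "\<And>n. ln (wsum n s) \<le> n * L + s * ln 2"
    using almost_additive_limit[of "\<lambda>n. ln (wsum n s)" "s * ln 2", OF _ le ge] by auto
  have "pres s = L" unfolding pres_def using L(1) by (rule limI)
  with L show "(\<lambda>n. ln (wsum n s) / n) \<longlonglongrightarrow> pres s"
    "n * pres s \<le> ln (wsum n s)" "ln (wsum n s) \<le> n * pres s + s * ln 2" by auto
qed

lemma P1_eq_pres:
  assumes "2 * (t - q) > 1"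
  shows "P1 t q = pres (2 * (t - q))"
  unfolding P1_def pres_def by (simp add: partition_sum_eq_wsum[OF assms])

lemma wsum_log_convex:
  assumes "s > 1" "t > 1" "u \<ge> 0" "v \<ge> 0" "u + v = 1"
  shows "wsum n (u * s + v * t) \<le> wsum n s powr u * wsum n t powr v"
proof -
  have gt: "u * s + v * t > 1"
  proof -
    have "0 < u * (s - 1) + v * (t - 1)"
    proof (cases "u = 0")
      case False
      thus ?thesis using assms by (intro add_pos_nonneg mult_pos_pos mult_nonneg_nonneg) auto
    qed (use assms in auto)
    thus ?thesis using assms(5) by (simp add: algebra_simps)
  qed
  note pos = wsum_pos[OF assms(1), of n] wsum_pos[OF assms(2), of n]
  let ?c = "wsum n s powr u * wsum n t powr v"
  have "((\<lambda>w. ?c * (u * (cont w powr (- s) * (1 / wsum n s)) + v * (cont w powr (- t) * (1 / wsum n t))))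
      has_sum ?c * (u * (wsum n s * (1 / wsum n s)) + v * (wsum n t * (1 / wsum n t)))) (words n)"
    by (intro has_sum_cmult_right has_sum_add has_sum_cmult_left has_sum_wsum assms)
  hence sum: "((\<lambda>w. ?c * (u * (cont w powr (- s) / wsum n s) + v * (cont w powr (- t) / wsum n t)))
      has_sum ?c) (words n)"
    using pos assms(5) by simp
  show ?thesis
  proof (rule has_sum_mono[OF has_sum_wsum[OF gt] sum])
    fix w assume "w \<in> words n"
    hence c: "cont w > 0" using cont_ge_1[of w n] by linarith
    have "(cont w powr (- s) / wsum n s) powr u * (cont w powr (- t) / wsum n t) powr v \<le>
        u * (cont w powr (- s) / wsum n s) + v * (cont w powr (- t) / wsum n t)"
      by (rule Youngs_inequality_0) (use assms pos c in auto)
    hence "?c * ((cont w powr (- s) / wsum n s) powr u * (cont w powr (- t) / wsum n t) powr v) \<le>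
        ?c * (u * (cont w powr (- s) / wsum n s) + v * (cont w powr (- t) / wsum n t))"
      by (intro mult_left_mono) auto
    also have "?c * ((cont w powr (- s) / wsum n s) powr u * (cont w powr (- t) / wsum n t) powr v) =
        cont w powr (- (u * s + v * t))"
      using pos c by (simp add: powr_divide powr_powr flip: powr_add) (simp add: algebra_simps)
    finally show "cont w powr (- (u * s + v * t)) \<le>
        ?c * (u * (cont w powr (- s) / wsum n s) + v * (cont w powr (- t) / wsum n t))" .
  qed
qed

lemma convex_on_pres: "convex_on {1<..} pres"
proof (rule convex_onI)
  fix u s t :: real assume u: "0 < u" "u < 1" and st: "s \<in> {1<..}" "t \<in> {1<..}"
  have gt: "(1 - u) * s + u * t > 1"
  proof -
    have "(1 - u) * 1 + u * 1 < (1 - u) * s + u * t"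
      using u st by (intro add_strict_mono mult_strict_left_mono) auto
    thus ?thesis by simp
  qed
  have "ln (wsum n ((1 - u) * s + u * t)) / n
      \<le> (1 - u) * (ln (wsum n s) / n) + u * (ln (wsum n t) / n)" for n
  proof -
    have "ln (wsum n ((1 - u) * s + u * t)) \<le> ln (wsum n s powr (1 - u) * wsum n t powr u)"
      using wsum_log_convex[of s t "1 - u" u n] wsum_pos[OF gt, of n] u st by simp
    also have "\<dots> = (1 - u) * ln (wsum n s) + u * ln (wsum n t)"
      using wsum_pos[of s n] wsum_pos[of t n] st by (simp add: ln_mult_pos ln_powr)
    finally have "ln (wsum n ((1 - u) * s + u * t)) / n
        \<le> ((1 - u) * ln (wsum n s) + u * ln (wsum n t)) / n"
      by (rule divide_right_mono) simp
    thus ?thesis by (simp add: add_divide_distrib)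
  qed
  thus "pres ((1 - u) *\<^sub>R s + u *\<^sub>R t) \<le> (1 - u) * pres s + u * pres t"
    using st gt by (intro LIMSEQ_le[OF pres_tendsto[of "(1 - u) *\<^sub>R s + u *\<^sub>R t"]
        tendsto_add[OF tendsto_mult[OF tendsto_const pres_tendsto]
          tendsto_mult[OF tendsto_const pres_tendsto]]]) auto
qed auto

definition golden :: real where
  "golden = (1 + sqrt 5) / 2"

lemma golden_gt_1: "golden > 1"
  by (simp add: golden_def)

lemma golden_sq: "golden * golden = golden + 1"
  by (simp add: golden_def field_simps)

lemma golden_power_le_cont:
  assumes "set ws \<subseteq> {1..}"
  shows "golden ^ length ws \<le> golden * cont ws"
  using assms
proof (induction ws rule: induct_list012)
  case 1
  show ?case using golden_gt_1 by simp
next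
  case (2 w)
  thus ?case using golden_gt_1 by simp
next
  case (3 w v vs)
  have pos: "cont (v # vs) \<ge> 1" using 3(3) by (intro den_ge_1) auto
  have "golden ^ length (w # v # vs) = (golden * golden) * golden ^ length vs"
    by simp
  also have "\<dots> = golden ^ length (v # vs) + golden ^ length vs"
    by (simp add: golden_sq algebra_simps)
  also have "\<dots> \<le> golden * cont (v # vs) + golden * cont vs"
    using 3 by (intro add_mono) auto
  also have "\<dots> = golden * (1 * cont (v # vs) + cont vs)"
    by (simp only: distrib_left mult_1)
  also have "\<dots> \<le> golden * (real w * cont (v # vs) + cont vs)"
    using golden_gt_1 3(3) pos by (intro mult_left_mono add_mono mult_right_mono) auto
  also have "real w * cont (v # vs) + cont vs = cont (w # v # vs)"
    using 3(3) by (intro den_Cons_Cons[symmetric]) auto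
  finally show ?case .
qed

lemma cont_replicate_1_le: "cont (replicate n 1) \<le> golden ^ n"
proof (induction n rule: induct_nat_012)
  case (ge2 n)
  have "cont (replicate (Suc (Suc n)) 1) = cont (replicate (Suc n) 1) + cont (replicate n 1)"
    using den_Cons_Cons[of 1 0 1 "replicate n 1"] by (simp del: den.simps)
  also have "\<dots> \<le> golden ^ Suc n + golden ^ n"
    using ge2 by (intro add_mono)
  also have "\<dots> = golden ^ Suc (Suc n)"
    using golden_sq by (simp add: algebra_simps flip: mult.assoc)
  finally show ?case .
qed (use golden_gt_1 in auto)

lemma pres_ge_golden:
  assumes "s > 1"
  shows "- s * ln golden \<le> pres s"
proof (rule LIMSEQ_le_const[OF pres_tendsto[OF assms]], intro exI[of _ 1] allI impI)
  fix n :: nat assume n: "n \<ge> 1"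
  have w: "replicate n 1 \<in> words n" by (auto simp: words_def)
  have "golden powr (- s * n) = (golden ^ n) powr (- s)"
    using golden_gt_1 by (simp add: powr_powr mult.commute flip: powr_realpow)
  also have "\<dots> \<le> cont (replicate n 1) powr (- s)"
    using cont_replicate_1_le[of n] cont_ge_1[OF w] assms by (intro powr_mono2') auto
  also have "\<dots> \<le> wsum n s"
    by (rule wsum_ge_term[OF assms w])
  finally have "ln (golden powr (- s * n)) \<le> ln (wsum n s)"
    using golden_gt_1 wsum_pos[OF assms] by (subst ln_le_cancel_iff) auto
  thus "- s * ln golden \<le> ln (wsum n s) / n"
    using n golden_gt_1 by (simp add: field_simps ln_powr)
qed

lemma pres_le_golden:
  assumes "s \<ge> 2"
  shows "pres s \<le> pres 2 - (s - 2) * ln golden"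
proof -
  have "(\<lambda>n. (s - 2) * ln golden * (1 / n) + (ln (wsum n 2) / n - (s - 2) * ln golden))
      \<longlonglongrightarrow> (s - 2) * ln golden * 0 + (pres 2 - (s - 2) * ln golden)"
    by (intro tendsto_intros lim_1_over_n pres_tendsto) auto
  moreover have "ln (wsum n s) / n \<le>
      (s - 2) * ln golden * (1 / n) + (ln (wsum n 2) / n - (s - 2) * ln golden)"
    if n: "n \<ge> 1" for n :: nat
  proof -
    let ?g = "golden powr (- (s - 2) * (real n - 1))"
    have "wsum n s \<le> ?g * wsum n 2"
    proof (rule has_sum_mono[OF has_sum_wsum has_sum_cmult_right[OF has_sum_wsum]])
      fix w assume w: "w \<in> words n"
      have "golden powr (real n - 1) \<le> cont w"
        using golden_power_le_cont[of w] w golden_gt_1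
        by (simp add: words_def powr_diff powr_realpow divide_le_eq mult.commute)
      hence "cont w powr (- (s - 2)) \<le> (golden powr (real n - 1)) powr (- (s - 2))"
        using assms golden_gt_1 by (intro powr_mono2') auto
      hence "cont w powr (- (s - 2)) * cont w powr (- 2) \<le> ?g * cont w powr (- 2)"
        by (intro mult_right_mono) (auto simp: powr_powr mult.commute)
      thus "cont w powr (- s) \<le> ?g * cont w powr (- 2)"
        by (simp flip: powr_add)
    qed (use assms in auto)
    hence "ln (wsum n s) \<le> ln (?g * wsum n 2)"
      using wsum_pos[of s n] wsum_pos[of 2 n] golden_gt_1 assms
      by (subst ln_le_cancel_iff) auto
    also have "\<dots> = - (s - 2) * (real n - 1) * ln golden + ln (wsum n 2)"
      using wsum_pos[of 2 n] golden_gt_1 by (simp add: ln_mult_pos ln_powr)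
    finally have "ln (wsum n s) / n \<le> (- (s - 2) * (real n - 1) * ln golden + ln (wsum n 2)) / n"
      by (rule divide_right_mono) simp
    also have "\<dots> = (s - 2) * ln golden * (1 / n) + (ln (wsum n 2) / n - (s - 2) * ln golden)"
      using n by (simp add: field_simps)
    finally show ?thesis .
  qed
  ultimately show ?thesis
    using LIMSEQ_le[OF pres_tendsto[of s]] assms by force
qed

section \<open>Decay of the variance\<close>

lemma sum_shift_periodic:
  fixes f :: "nat \<Rightarrow> real"
  assumes "\<And>i. f (i + N) = f i"
  shows "(\<Sum>i<N. f (i + n)) = (\<Sum>i<N. f i)"
proof (induction n)
  case (Suc n)
  have "(\<Sum>i<N. f (Suc i + n)) + f n = (\<Sum>i<Suc N. f (i + n))"
    by (simp only: sum.lessThan_Suc_shift) simp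
  also have "\<dots> = (\<Sum>i<N. f (i + n)) + f n"
    using assms[of n] by (simp add: add.commute)
  finally show ?case using Suc by simp
qed simp

definition osc :: "real \<Rightarrow> nat \<Rightarrow> nat list \<Rightarrow> nat list \<Rightarrow> real" where
  "osc \<tau> n us vs = (cont us powr (- \<tau> / n) - cont vs powr (- \<tau> / n))\<^sup>2"

lemma take_rotate_double:
  assumes "2 * n \<le> length ws" "n > 0"
  shows "take (2 * n) (rotate i ws) = take n (rotate i ws) @ take n (rotate (i + n) ws)"
proof -
  let ?v = "rotate i ws"
  have l: "length ?v = length ws" by simp
  have "rotate (i + n) ws = rotate n ?v"
    by (simp add: rotate_rotate add.commute)
  also have "\<dots> = drop n ?v @ take n ?v"
    using assms by (simp add: rotate_drop_take)
  finally have "take n (rotate (i + n) ws) = take n (drop n ?v)"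
    using assms by simp
  thus ?thesis by (simp add: take_add mult_2)
qed

lemma rotate_periodic: "length ws = N \<Longrightarrow> rotate (i + N) ws = rotate i ws"
  by (metis mod_add_self2 rotate_conv_mod)

lemma sum_osc_rotations_le:
  assumes ws: "ws \<in> words N" and n: "2 * n \<le> N" "n > 0" and \<tau>: "\<tau> \<ge> 0"
  shows "(\<Sum>i<N. cont (take (2 * n) (rotate i ws)) powr (- 2 * \<tau> / (2 * n)))
    + (\<Sum>i<N. osc \<tau> n (take n (rotate i ws)) (take n (rotate (i + n) ws))) / 2
    \<le> (\<Sum>i<N. cont (take n (rotate i ws)) powr (- 2 * \<tau> / n))"
proof -
  define y where "y i = cont (take n (rotate i ws)) powr (- \<tau> / n)" for i
  have len: "length ws = N" using ws by (simp add: words_def)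
  have w: "take n (rotate i ws) \<in> words n" for i
    using ws n by (intro take_in_words) auto
  have y2: "cont (take n (rotate i ws)) powr (- 2 * \<tau> / n) = (y i)\<^sup>2" for i
    using cont_ge_1[OF w[of i]] by (simp add: y_def powr_power)
  have "cont (take (2 * n) (rotate i ws)) powr (- 2 * \<tau> / (2 * n)) \<le> y i * y (i + n)" for i
  proof -
    have c: "cont (take n (rotate i ws)) \<ge> 1" "cont (take n (rotate (i + n) ws)) \<ge> 1"
      using cont_ge_1 w by blast+
    have "cont (take (2 * n) (rotate i ws)) powr (- \<tau> / n) \<le>
        (cont (take n (rotate i ws)) * cont (take n (rotate (i + n) ws))) powr (- \<tau> / n)"
      using c cont_append_ge[of "take n (rotate i ws)" "take n (rotate (i + n) ws)"] w \<tau> n len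
      by (intro powr_mono2') (auto simp: take_rotate_double words_def intro: mult_pos_pos)
    thus ?thesis using c by (simp add: powr_mult y_def)
  qed
  hence "(\<Sum>i<N. cont (take (2 * n) (rotate i ws)) powr (- 2 * \<tau> / (2 * n)))
      \<le> (\<Sum>i<N. y i * y (i + n))"
    by (intro sum_mono)
  also have "\<dots> = (\<Sum>i<N. (y i)\<^sup>2 / 2 + (y (i + n))\<^sup>2 / 2 - (y i - y (i + n))\<^sup>2 / 2)"
    by (intro sum.cong) (auto simp: power2_eq_square field_simps)
  also have "\<dots> = (\<Sum>i<N. (y i)\<^sup>2) / 2 + (\<Sum>i<N. (y (i + n))\<^sup>2) / 2
      - (\<Sum>i<N. (y i - y (i + n))\<^sup>2) / 2"
    by (simp add: sum.distrib sum_subtractf sum_divide_distrib)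
  also have "(\<Sum>i<N. (y (i + n))\<^sup>2) = (\<Sum>i<N. (y i)\<^sup>2)"
    by (rule sum_shift_periodic) (simp add: y_def rotate_periodic[OF len])
  finally have "(\<Sum>i<N. cont (take (2 * n) (rotate i ws)) powr (- 2 * \<tau> / (2 * n)))
      + (\<Sum>i<N. (y i - y (i + n))\<^sup>2) / 2 \<le> (\<Sum>i<N. (y i)\<^sup>2)"
    by simp
  thus ?thesis unfolding y2 osc_def y_def by simp
qed

lemma sum_osc_scales_le:
  assumes ws: "ws \<in> words (2 ^ K)" and \<tau>: "\<tau> \<ge> 0"
  shows "(\<Sum>k<K. \<Sum>i<2 ^ K. osc \<tau> (2 ^ k) (take (2 ^ k) (rotate i ws))
    (take (2 ^ k) (rotate (i + 2 ^ k) ws))) \<le> 2 * 2 ^ K"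
proof -
  define a where
    "a k = (\<Sum>i<2 ^ K. cont (take (2 ^ k) (rotate i ws)) powr (- 2 * \<tau> / real (2 ^ k)))" for k
  define d where
    "d k = (\<Sum>i<2 ^ K. osc \<tau> (2 ^ k) (take (2 ^ k) (rotate i ws))
      (take (2 ^ k) (rotate (i + 2 ^ k) ws)))" for k
  have step: "d k \<le> 2 * a k - 2 * a (Suc k)" if "k < K" for k
  proof -
    have "(2::nat) * 2 ^ k = 2 ^ Suc k" by simp
    also have "\<dots> \<le> 2 ^ K" using that by (intro power_increasing) auto
    finally have "2 * (2::nat) ^ k \<le> 2 ^ K" .
    from sum_osc_rotations_le[OF ws this _ \<tau>] show ?thesis
      by (simp add: a_def d_def)
  qed
  have "(\<Sum>k<K. d k) \<le> (\<Sum>k<K. 2 * a k - 2 * a (Suc k))"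
    by (intro sum_mono step) auto
  also have "\<dots> = 2 * a 0 - 2 * a K"
    by (induction K) auto
  also have "\<dots> \<le> 2 * a 0"
    by (simp add: a_def sum_nonneg)
  also have "a 0 \<le> (\<Sum>i<(2::nat) ^ K. 1)"
    unfolding a_def
  proof (rule sum_mono)
    fix i
    have w: "take (2 ^ 0) (rotate i ws) \<in> words (2 ^ 0)"
      using ws by (intro take_in_words) auto
    show "cont (take (2 ^ 0) (rotate i ws)) powr (- 2 * \<tau> / real (2 ^ 0)) \<le> 1"
      using powr_mono[of "- 2 * \<tau>" 0 "cont (take (2 ^ 0) (rotate i ws))"] cont_ge_1[OF w] \<tau> by simp
  qed
  finally show ?thesis by (simp add: d_def)
qed

lemma summable_cont_powr_mult:
  assumes "s > 1" "\<And>ws. ws \<in> words n \<Longrightarrow> F ws \<in> {0..1}"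
  shows "(\<lambda>ws. cont ws powr (- s) * F ws) summable_on words n"
  by (rule summable_on_comparison_test[OF summable_cont_powr[OF assms(1)]])
     (use assms(2) in \<open>auto intro: mult_left_le\<close>)

lemma infsum_prefix_ge:
  assumes s: "s > 1" and F: "\<And>us. us \<in> words m \<Longrightarrow> F us \<in> {0..1}"
  shows "2 powr (- s) * (wsum n s * (\<Sum>\<^sub>\<infinity>us\<in>words m. cont us powr (- s) * F us))
    \<le> (\<Sum>\<^sub>\<infinity>ws\<in>words (m + n). cont ws powr (- s) * F (take m ws))"
proof -
  have "((\<lambda>ws. cont ws powr (- s) * F (take m ws)) has_sum
      (\<Sum>\<^sub>\<infinity>ws\<in>words (m + n). cont ws powr (- s) * F (take m ws))) (words (m + n))"
    by (intro has_sum_infsum summable_cont_powr_mult s F) (auto intro: take_in_words)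
  hence 1: "((\<lambda>(us, vs). cont (us @ vs) powr (- s) * F (take m (us @ vs))) has_sum
      (\<Sum>\<^sub>\<infinity>ws\<in>words (m + n). cont ws powr (- s) * F (take m ws))) (words m \<times> words n)"
    using has_sum_reindex_bij_betw[OF bij_betw_append_words,
        of "\<lambda>ws. cont ws powr (- s) * F (take m ws)" m n]
    by (simp add: case_prod_unfold)
  have "((\<lambda>(us, vs). (cont us powr (- s) * F us) * cont vs powr (- s)) has_sum
      (\<Sum>\<^sub>\<infinity>us\<in>words m. cont us powr (- s) * F us) * wsum n s) (words m \<times> words n)"
    by (intro has_sum_product_real has_sum_wsum has_sum_infsum summable_cont_powr_mult s F)
       (use F in auto)
  from has_sum_cmult_right[OF this, of "2 powr (- s)"] 1 show ?thesis
    unfolding mult.commute[of "wsum n s"]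
  proof (rule has_sum_mono, safe)
    fix us vs assume w: "us \<in> words m" "vs \<in> words n"
    have "2 powr (- s) * (cont us powr (- s) * cont vs powr (- s)) * F us
        \<le> cont (us @ vs) powr (- s) * F us"
      using w F[of us] s by (intro mult_right_mono cont_append_powr_ge) auto
    thus "2 powr (- s) * ((cont us powr (- s) * F us) * cont vs powr (- s))
        \<le> cont (us @ vs) powr (- s) * F (take m (us @ vs))"
      using w by (simp add: mult_ac words_def)
  qed
qed

definition defect :: "real \<Rightarrow> real \<Rightarrow> nat \<Rightarrow> real" where
  "defect s \<tau> n = wsum n s * wsum n (s + 2 * (\<tau> / n)) - (wsum n (s + \<tau> / n))\<^sup>2"

lemma osc_has_sum_defect:
  assumes "s > 1" "\<tau> \<ge> 0"
  shows "((\<lambda>(us, vs). cont us powr (- s) * cont vs powr (- s) * osc \<tau> n us vs)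
    has_sum 2 * defect s \<tau> n) (words n \<times> words n)"
proof -
  define h where "h = \<tau> / n"
  have h: "h \<ge> 0" using assms by (simp add: h_def)
  let ?p = "\<lambda>r us. cont us powr (- r)"
  have 1: "((\<lambda>(us, vs). ?p s us * ?p (s + 2 * h) vs) has_sum wsum n s * wsum n (s + 2 * h))
      (words n \<times> words n)"
    using assms h by (intro has_sum_product_real has_sum_wsum) auto
  have 2: "((\<lambda>(us, vs). ?p (s + 2 * h) us * ?p s vs) has_sum wsum n (s + 2 * h) * wsum n s)
      (words n \<times> words n)"
    using assms h by (intro has_sum_product_real has_sum_wsum) auto
  have 3: "((\<lambda>(us, vs). ?p (s + h) us * ?p (s + h) vs) has_sum wsum n (s + h) * wsum n (s + h))
      (words n \<times> words n)"
    using assms h by (intro has_sum_product_real has_sum_wsum) auto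
  note sum = has_sum_add[OF has_sum_add[OF 1 2] has_sum_cmult_right[OF 3, of "- 2"]]
  have sumval: "wsum n s * wsum n (s + 2 * h) + wsum n (s + 2 * h) * wsum n s
      + - 2 * (wsum n (s + h) * wsum n (s + h)) = 2 * defect s \<tau> n"
    by (simp add: defect_def h_def power2_eq_square)
  have "((\<lambda>(us, vs). ?p s us * ?p s vs * osc \<tau> n us vs) has_sum 2 * defect s \<tau> n)
      (words n \<times> words n) \<longleftrightarrow> ((\<lambda>x. (case x of (us, vs) \<Rightarrow> ?p s us * ?p (s + 2 * h) vs) +
      (case x of (us, vs) \<Rightarrow> ?p (s + 2 * h) us * ?p s vs) +
      - 2 * (case x of (us, vs) \<Rightarrow> ?p (s + h) us * ?p (s + h) vs)) has_sum 2 * defect s \<tau> n)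
      (words n \<times> words n)"
  proof (rule has_sum_cong, safe)
    fix us vs
    show "?p s us * ?p s vs * osc \<tau> n us vs =
        ?p s us * ?p (s + 2 * h) vs + ?p (s + 2 * h) us * ?p s vs
        + - 2 * (?p (s + h) us * ?p (s + h) vs)"
    proof -
      have e: "?p (s + h) us = ?p s us * ?p h us" "?p (s + 2 * h) us = ?p s us * (?p h us)\<^sup>2"
for us
      proof -
        show "?p (s + h) us = ?p s us * ?p h us" by (simp flip: powr_add)
        have "- (s + 2 * h) = - s + (- h + - h)" by simp
        thus "?p (s + 2 * h) us = ?p s us * (?p h us)\<^sup>2"
          by (simp only: powr_add power2_eq_square)
      qed
      have o: "osc \<tau> n us vs = (?p h us - ?p h vs)\<^sup>2"
        by (simp add: osc_def h_def)
      show ?thesis unfolding e o by (simp add: power2_eq_square algebra_simps)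
    qed
  qed
  thus ?thesis using sum sumval by simp
qed

lemma defect_nonneg: "s > 1 \<Longrightarrow> \<tau> \<ge> 0 \<Longrightarrow> defect s \<tau> n \<ge> 0"
  using has_sum_nonneg[OF osc_has_sum_defect[of s \<tau> n]] by (auto simp: osc_def)

lemma osc_le_1:
  assumes "us \<in> words n" "vs \<in> words n" "\<tau> \<ge> 0"
  shows "osc \<tau> n us vs \<in> {0..1}"
proof -
  have *: "cont ws powr (- \<tau> / n) \<in> {0..1}" if "ws \<in> words n" for ws
    using cont_ge_1[OF that] assms(3) powr_mono[of "- \<tau> / n" 0 "cont ws"] by simp
  hence "\<bar>cont us powr (- \<tau> / n) - cont vs powr (- \<tau> / n)\<bar> \<le> 1"
    using *[OF assms(1)] *[OF assms(2)] unfolding atLeastAtMost_iff by linarith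
  thus ?thesis by (simp add: osc_def abs_square_le_1)
qed

text \<open>The words of length \<open>N\<close> with weights \<open>cont ws powr (- s)\<close> are almost rotation invariant,
  and two adjacent blocks of such a word are, up to constants, independent.\<close>

lemma infsum_osc_rotation_ge:
  assumes s: "s > 1" and \<tau>: "\<tau> \<ge> 0" and n: "2 * n \<le> N" "n > 0"
  defines "V \<equiv> defect s \<tau> n / (wsum n s)\<^sup>2"
  shows "2 * V * wsum N s / 8 powr s \<le>
    (\<Sum>\<^sub>\<infinity>ws\<in>words N. cont ws powr (- s) *
      osc \<tau> n (take n (rotate i ws)) (take n (rotate (i + n) ws)))"
proof -
  define F where "F us = osc \<tau> n (take n us) (drop n us)" for us
  define M where "M = N - 2 * n"
  have N: "N = (n + n) + M" using n by (simp add: M_def)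
  have F: "F us \<in> {0..1}" if "us \<in> words (n + n)" for us
    unfolding F_def using that \<tau> take_in_words[of us "n + n" n] drop_in_words[of us "n + n" n]
    by (intro osc_le_1) auto
  have F': "F (take (n + n) ws) \<in> {0..1}" if "ws \<in> words N" for ws
    using that N by (intro F take_in_words) auto
  have Frot: "osc \<tau> n (take n (rotate i ws)) (take n (rotate (i + n) ws)) =
      F (take (n + n) (rotate i ws))" if "ws \<in> words N" for ws
  proof -
    have "length ws = N" using that by (simp add: words_def)
    thus ?thesis using take_rotate_double[of n ws i] n by (simp add: F_def mult_2)
  qed
  have Z: "wsum n s > 0" "wsum M s > 0" using wsum_pos s by auto
  have "(\<Sum>\<^sub>\<infinity>us\<in>words (n + n). cont us powr (- s) * F us) \<ge> 2 powr (- s) * (2 * defect s \<tau> n)"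
  proof -
    have "((\<lambda>us. cont us powr (- s) * F us) has_sum
        (\<Sum>\<^sub>\<infinity>us\<in>words (n + n). cont us powr (- s) * F us)) (words (n + n))"
      by (intro has_sum_infsum summable_cont_powr_mult s F)
    hence "((\<lambda>(us, vs). cont (us @ vs) powr (- s) * F (us @ vs)) has_sum
        (\<Sum>\<^sub>\<infinity>us\<in>words (n + n). cont us powr (- s) * F us)) (words n \<times> words n)"
      using has_sum_reindex_bij_betw[OF bij_betw_append_words,
          of "\<lambda>ws. cont ws powr (- s) * F ws" n n]
      by (simp add: case_prod_unfold)
    with has_sum_cmult_right[OF osc_has_sum_defect[OF s \<tau>, of n], of "2 powr (- s)"]
    show ?thesis
    proof (rule has_sum_mono, safe)
      fix us vs assume w: "us \<in> words n" "vs \<in> words n"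
      have "2 powr (- s) * (cont us powr (- s) * cont vs powr (- s)) * osc \<tau> n us vs
          \<le> cont (us @ vs) powr (- s) * osc \<tau> n us vs"
        using w osc_le_1[OF w \<tau>] s by (intro mult_right_mono cont_append_powr_ge) auto
      moreover have "F (us @ vs) = osc \<tau> n us vs"
        using w by (simp add: F_def words_def)
      ultimately show "2 powr (- s) * (cont us powr (- s) * cont vs powr (- s) * osc \<tau> n us vs)
          \<le> cont (us @ vs) powr (- s) * F (us @ vs)"
        by (simp add: mult.assoc)
    qed
  qed
  hence "2 powr (- s) * (wsum M s * (2 powr (- s) * (2 * defect s \<tau> n)))
      \<le> 2 powr (- s) * (wsum M s * (\<Sum>\<^sub>\<infinity>us\<in>words (n + n). cont us powr (- s) * F us))"
    using Z by (intro mult_left_mono) auto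
  also have "\<dots> \<le> (\<Sum>\<^sub>\<infinity>ws\<in>words N. cont ws powr (- s) * F (take (n + n) ws))"
    unfolding N by (rule infsum_prefix_ge[OF s F])
  also have "\<dots> = (\<Sum>\<^sub>\<infinity>ws\<in>words N. cont (rotate i ws) powr (- s) * F (take (n + n) (rotate i ws)))"
    by (rule infsum_reindex_bij_betw[OF bij_betw_rotate_words, symmetric])
  also have "2 powr (- s) * \<dots> \<le> (\<Sum>\<^sub>\<infinity>ws\<in>words N. cont ws powr (- s) * F (take (n + n) (rotate i ws)))"
  proof (rule has_sum_mono)
    have "(\<lambda>ws. cont ws powr (- s) * F (take (n + n) ws)) summable_on words N"
      by (intro summable_cont_powr_mult s F')
    hence "(\<lambda>ws. cont (rotate i ws) powr (- s) * F (take (n + n) (rotate i ws))) summable_on words N"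
      using summable_on_reindex_bij_betw[OF bij_betw_rotate_words[of i N],
          of "\<lambda>ws. cont ws powr (- s) * F (take (n + n) ws)"] by simp
    thus "((\<lambda>ws. 2 powr (- s) * (cont (rotate i ws) powr (- s) * F (take (n + n) (rotate i ws))))
        has_sum 2 powr (- s) *
        (\<Sum>\<^sub>\<infinity>ws\<in>words N. cont (rotate i ws) powr (- s) * F (take (n + n) (rotate i ws)))) (words N)"
      by (intro has_sum_cmult_right has_sum_infsum)
    show "((\<lambda>ws. cont ws powr (- s) * F (take (n + n) (rotate i ws))) has_sum
        (\<Sum>\<^sub>\<infinity>ws\<in>words N. cont ws powr (- s) * F (take (n + n) (rotate i ws)))) (words N)"
      by (intro has_sum_infsum summable_cont_powr_mult s F') simp
  next
    fix ws assume ws: "ws \<in> words N"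
    have c: "cont ws \<ge> 1" "cont (rotate i ws) \<ge> 1"
      using cont_ge_1[of _ N] ws by auto
    have "(2 * cont (rotate i ws)) powr (- s) \<le> cont ws powr (- s)"
      using c cont_rotate_le[of ws i] ws s by (intro powr_mono2') (auto simp: words_def)
    hence "2 powr (- s) * cont (rotate i ws) powr (- s) \<le> cont ws powr (- s)"
      using c by (simp add: powr_mult)
    hence "2 powr (- s) * cont (rotate i ws) powr (- s) * F (take (n + n) (rotate i ws))
        \<le> cont ws powr (- s) * F (take (n + n) (rotate i ws))"
      using F'[of "rotate i ws"] ws by (intro mult_right_mono) auto
    thus "2 powr (- s) * (cont (rotate i ws) powr (- s) * F (take (n + n) (rotate i ws)))
        \<le> cont ws powr (- s) * F (take (n + n) (rotate i ws))"
      by (simp add: mult.assoc)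
  qed
  finally have main: "2 powr (- s) * (2 powr (- s) * (wsum M s * (2 powr (- s) * (2 * defect s \<tau> n))))
      \<le> (\<Sum>\<^sub>\<infinity>ws\<in>words N. cont ws powr (- s) * F (take (n + n) (rotate i ws)))"
    by simp
  have "wsum N s \<le> wsum (n + n) s * wsum M s"
    unfolding N by (rule wsum_add_le[OF s])
  also have "\<dots> \<le> (wsum n s)\<^sup>2 * wsum M s"
    using wsum_add_le[OF s, of n n] Z by (intro mult_right_mono) (auto simp: power2_eq_square)
  finally have "2 * V * wsum N s / 8 powr s \<le> 2 * V * ((wsum n s)\<^sup>2 * wsum M s) / 8 powr s"
    using defect_nonneg[OF s \<tau>, of n] by (intro divide_right_mono mult_left_mono) (auto simp: V_def)
  also have "\<dots> = (1 / 8 powr s) * (wsum M s * (2 * defect s \<tau> n))"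
    using Z by (simp add: V_def)
  also have "1 / 8 powr s = 2 powr (- s) * 2 powr (- s) * 2 powr (- s)"
  proof -
    have "(8::real) powr s = (2 * 2 * 2) powr s" by simp
    also have "\<dots> = 2 powr s * 2 powr s * 2 powr s" by (simp only: powr_mult)
    finally show ?thesis by (simp add: powr_minus field_simps)
  qed
  finally show ?thesis
    using main infsum_cong[of "words N" "\<lambda>ws. cont ws powr (- s) *
      osc \<tau> n (take n (rotate i ws)) (take n (rotate (i + n) ws))"] Frot
    by (simp add: mult_ac)
qed

lemma has_sum_sum_real:
  fixes f :: "'a \<Rightarrow> 'b \<Rightarrow> real"
  assumes "\<And>i. i \<in> I \<Longrightarrow> (f i has_sum S i) A"
  shows "((\<lambda>x. \<Sum>i\<in>I. f i x) has_sum (\<Sum>i\<in>I. S i)) A"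
  using assms
proof (induction I rule: infinite_finite_induct)
  case (insert i I)
  thus ?case by (auto intro!: has_sum_add)
qed auto

lemma sum_defect_le:
  assumes s: "s > 1" and \<tau>: "\<tau> \<ge> 0"
  shows "(\<Sum>k<K. defect s \<tau> (2 ^ k) / (wsum (2 ^ k) s)\<^sup>2) \<le> 8 powr s"
proof -
  define N :: nat where "N = 2 ^ K"
  define G where "G k i ws = osc \<tau> (2 ^ k) (take (2 ^ k) (rotate i ws))
    (take (2 ^ k) (rotate (i + 2 ^ k) ws))" for k i ws
  define S where "S k i = (\<Sum>\<^sub>\<infinity>ws\<in>words N. cont ws powr (- s) * G k i ws)" for k i
  define V where "V k = defect s \<tau> (2 ^ k) / (wsum (2 ^ k) s)\<^sup>2" for k
  have G: "G k i ws \<in> {0..1}" if "ws \<in> words N" "k < K" for k i ws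
    unfolding G_def using that
    by (intro osc_le_1 \<tau> take_in_words[of _ N]) (auto simp: N_def)
  have Z: "wsum N s > 0" using wsum_pos s by auto
  have lower: "2 * V k * wsum N s / 8 powr s \<le> S k i" if "k < K" for k i
  proof -
    have "(2::nat) * 2 ^ k = 2 ^ Suc k" by simp
    also have "\<dots> \<le> N" unfolding N_def using that by (intro power_increasing) auto
    finally show ?thesis
      unfolding S_def V_def G_def by (intro infsum_osc_rotation_ge s \<tau>) auto
  qed
  have "((\<lambda>ws. \<Sum>k<K. \<Sum>i<N. cont ws powr (- s) * G k i ws) has_sum (\<Sum>k<K. \<Sum>i<N. S k i)) (words N)"
    unfolding S_def
    by (intro has_sum_sum_real has_sum_infsum summable_cont_powr_mult s G) auto
  moreover have "((\<lambda>ws. cont ws powr (- s) * (2 * N)) has_sum wsum N s * (2 * N)) (words N)"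
    by (intro has_sum_cmult_left has_sum_wsum s)
  ultimately have "(\<Sum>k<K. \<Sum>i<N. S k i) \<le> wsum N s * (2 * N)"
  proof (rule has_sum_mono)
    fix ws assume "ws \<in> words N"
    hence "(\<Sum>k<K. \<Sum>i<N. G k i ws) \<le> 2 * N"
      using sum_osc_scales_le[of ws K \<tau>] \<tau> by (simp add: N_def G_def)
    hence "cont ws powr (- s) * (\<Sum>k<K. \<Sum>i<N. G k i ws) \<le> cont ws powr (- s) * (2 * N)"
      by (intro mult_left_mono) auto
    thus "(\<Sum>k<K. \<Sum>i<N. cont ws powr (- s) * G k i ws) \<le> cont ws powr (- s) * (2 * N)"
      by (simp add: sum_distrib_left)
  qed
  moreover have "(\<Sum>k<K. \<Sum>i<N. 2 * V k * wsum N s / 8 powr s) \<le> (\<Sum>k<K. \<Sum>i<N. S k i)"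
    by (intro sum_mono lower) auto
  moreover have "(\<Sum>k<K. \<Sum>i<N. 2 * V k * wsum N s / 8 powr s) =
      (\<Sum>k<K. V k) * (2 * N * wsum N s / 8 powr s)"
    unfolding sum_distrib_right by (intro sum.cong) auto
  ultimately have "(\<Sum>k<K. V k) * (2 * N * wsum N s / 8 powr s)
      \<le> 8 powr s * (2 * N * wsum N s / 8 powr s)"
    by (simp add: mult_ac)
  moreover have "2 * N * wsum N s / 8 powr s > 0" using Z by (simp add: N_def)
  ultimately have "(\<Sum>k<K. V k) \<le> 8 powr s"
    by (simp only: mult_le_cancel_right_pos)
  thus ?thesis by (simp add: V_def)
qed

lemma defect_tendsto_0:
  assumes "s > 1" "\<tau> \<ge> 0"
  shows "(\<lambda>k. defect s \<tau> (2 ^ k) / (wsum (2 ^ k) s)\<^sup>2) \<longlonglongrightarrow> 0"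
proof (rule summable_LIMSEQ_zero, rule summableI_nonneg_bounded)
  show "0 \<le> defect s \<tau> (2 ^ k) / (wsum (2 ^ k) s)\<^sup>2" for k
    using defect_nonneg[OF assms] by simp
  show "(\<Sum>k<K. defect s \<tau> (2 ^ k) / (wsum (2 ^ k) s)\<^sup>2) \<le> 8 powr s" for K
    by (rule sum_defect_le[OF assms])
qed

section \<open>Differentiability\<close>

lemma wsum_mult_le:
  assumes s: "s > 1" and h: "\<bar>2 * h\<bar> < s - 1" and c: "c > 0"
  shows "wsum n (s + h) * wsum n (s - h) / (wsum n s)\<^sup>2 - 1 \<le>
    (c * ((wsum n s * wsum n (s + 2 * h) - (wsum n (s + h))\<^sup>2) / (wsum n s)\<^sup>2)
      + wsum n (s - 2 * h) / wsum n s / c) / 2"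
proof -
  define m where "m = wsum n (s + h) / wsum n s"
  let ?p = "\<lambda>r w. cont w powr (- r)"
  have gt: "s + h > 1" "s - h > 1" "s + 2 * h > 1" "s - 2 * h > 1"
    using h by (auto simp: abs_less_iff)
  have Z: "wsum n s > 0" using wsum_pos s by auto
  have "((\<lambda>w. m * ?p (s - h) w + (- 1) * ?p s w) has_sum m * wsum n (s - h) + (- 1) * wsum n s) (words n)"
    by (intro has_sum_add has_sum_cmult_right has_sum_wsum gt s)
  moreover have "((\<lambda>w. c / 2 * (m\<^sup>2 * ?p s w + (- 2 * m) * ?p (s + h) w + ?p (s + 2 * h) w)
      + 1 / (2 * c) * ?p (s - 2 * h) w) has_sum
      c / 2 * (m\<^sup>2 * wsum n s + (- 2 * m) * wsum n (s + h) + wsum n (s + 2 * h))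
      + 1 / (2 * c) * wsum n (s - 2 * h)) (words n)"
    by (intro has_sum_add has_sum_cmult_right has_sum_wsum gt s)
  ultimately have "m * wsum n (s - h) + (- 1) * wsum n s \<le>
      c / 2 * (m\<^sup>2 * wsum n s + (- 2 * m) * wsum n (s + h) + wsum n (s + 2 * h))
      + 1 / (2 * c) * wsum n (s - 2 * h)"
  proof (rule has_sum_mono)
    fix w assume "w \<in> words n"
    hence w: "cont w > 0" using cont_ge_1[of w n] by linarith
    define x where "x = ?p h w"
    have x: "x > 0" using w by (simp add: x_def)
    have e: "?p (s + h) w = ?p s w * x" "?p (s + 2 * h) w = ?p s w * (x * x)"
      "?p (s - h) w = ?p s w * (1 / x)" "?p (s - 2 * h) w = ?p s w * (1 / x * (1 / x))"
      unfolding x_def using w by (simp_all add: divide_inverse flip: powr_add powr_minus)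
    \<comment> \<open>AM-GM for \<open>c * (m - x)\<close> and \<open>1 / x\<close>\<close>
    have "0 \<le> (c * (m - x) - 1 / x)\<^sup>2 / (2 * c)" using c by simp
    also have "\<dots> = c / 2 * (m\<^sup>2 + (- 2 * m) * x + x * x) + 1 / (2 * c) * (1 / x * (1 / x))
        - (m * (1 / x) + (- 1))"
      using c x by (simp add: field_simps power2_eq_square)
    finally have "?p s w * (m * (1 / x) + (- 1)) \<le>
        ?p s w * (c / 2 * (m\<^sup>2 + (- 2 * m) * x + x * x) + 1 / (2 * c) * (1 / x * (1 / x)))"
      by (intro mult_left_mono) auto
    thus "m * ?p (s - h) w + (- 1) * ?p s w \<le>
        c / 2 * (m\<^sup>2 * ?p s w + (- 2 * m) * ?p (s + h) w + ?p (s + 2 * h) w)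
        + 1 / (2 * c) * ?p (s - 2 * h) w"
      unfolding e by (simp only: algebra_simps)
  qed
  hence "(m * wsum n (s - h) + (- 1) * wsum n s) / wsum n s \<le>
      (c / 2 * (m\<^sup>2 * wsum n s + (- 2 * m) * wsum n (s + h) + wsum n (s + 2 * h))
      + 1 / (2 * c) * wsum n (s - 2 * h)) / wsum n s"
    by (rule divide_right_mono) (use Z in auto)
  also have "(m * wsum n (s - h) + (- 1) * wsum n s) / wsum n s =
      wsum n (s + h) * wsum n (s - h) / (wsum n s)\<^sup>2 - 1"
    using Z by (simp add: m_def diff_divide_distrib power2_eq_square)
  also have "(c / 2 * (m\<^sup>2 * wsum n s + (- 2 * m) * wsum n (s + h) + wsum n (s + 2 * h))
      + 1 / (2 * c) * wsum n (s - 2 * h)) / wsum n s =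
      (c * (wsum n (s + 2 * h) / wsum n s - m\<^sup>2) + wsum n (s - 2 * h) / wsum n s / c) / 2"
  proof -
    have m: "wsum n (s + h) = m * wsum n s" using Z by (simp add: m_def)
    show ?thesis unfolding m using Z c by (simp add: field_simps power2_eq_square)
  qed
  also have "wsum n (s + 2 * h) / wsum n s - m\<^sup>2 =
      (wsum n s * wsum n (s + 2 * h) - (wsum n (s + h))\<^sup>2) / (wsum n s)\<^sup>2"
    using Z by (simp add: m_def diff_divide_distrib power2_eq_square)
  finally show ?thesis .
qed

lemma convex_slope_mono:
  fixes f :: "real \<Rightarrow> real"
  assumes f: "convex_on I f" and I: "x \<in> I" "y \<in> I" "u \<in> I" "v \<in> I"
    and xy: "x < y" "u < v" "x \<le> u" "y \<le> v"
  shows "(f y - f x) / (y - x) \<le> (f v - f u) / (v - u)"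
proof -
  have flip: "(f a - f b) / (a - b) = (f b - f a) / (b - a)" for a b
    by (metis minus_diff_eq minus_divide_divide)
  have "(f y - f x) / (y - x) \<le> (f v - f x) / (v - x)"
    using convex_on_slope_le(1)[OF f I(1,4), of y] xy by (cases "y = v") (auto simp: flip[of x])
  also have "\<dots> \<le> (f v - f u) / (v - u)"
    using convex_on_slope_le(2)[OF f I(1,4), of u] xy by (cases "x = u") (auto simp: flip[of _ v])
  finally show ?thesis .
qed

lemma convex_on_has_derivative_second_difference:
  fixes f :: "real \<Rightarrow> real"
  assumes f: "convex_on {a<..} f" and s: "s > a"
    and small: "\<And>e. e > 0 \<Longrightarrow> \<exists>h>0. s - h > a \<and> f (s + h) + f (s - h) - 2 * f s \<le> e * h"
  shows "f differentiable (at s)"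
proof -
  define slope where "slope h = (f (s + h) - f s) / h" for h
  have sl: "slope h = (f (s + h) - f s) / (s + h - s)" for h by (simp add: slope_def)
  have sl': "slope h = (f s - f (s + h)) / (s - (s + h))" for h
    by (simp add: slope_def diff_divide_distrib)
  have mono: "slope h \<le> slope k" if hk: "h \<le> k" "h \<noteq> 0" "k \<noteq> 0" "s + h > a" for h k
  proof -
    have I: "s \<in> {a<..}" "s + h \<in> {a<..}" "s + k \<in> {a<..}" using hk s by auto
    consider "0 < h" | "h < 0" "0 < k" | "k < 0"
      using hk(2,3) by (metis linorder_neqE_linordered_idom)
    thus ?thesis
    proof cases
      case 1
      thus ?thesis using convex_slope_mono[OF f I(1,2) I(1,3)] hk by (simp add: slope_def)
    next
      case 2
      thus ?thesis using convex_slope_mono[OF f I(2,1) I(1,3)] hk sl'[of h] sl[of k] by simp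
    next
      case 3
      thus ?thesis using convex_slope_mono[OF f I(2,1) I(3,1)] hk sl'[of h] sl'[of k] by simp
    qed
  qed
  define D where "D = Inf (slope ` {0<..})"
  have D_le: "D \<le> slope k" if "k > 0" for k
    unfolding D_def
  proof (rule cINF_lower)
    have "(a - s) / 2 < 0" "s + (a - s) / 2 > a" using s by (auto simp: field_simps)
    thus "bdd_below (slope ` {0<..})"
      by (intro bdd_belowI[of _ "slope ((a - s) / 2)"]) (auto intro!: mono)
  qed (use that in auto)
  have D_ge: "slope h \<le> D" if "h < 0" "s + h > a" for h
    unfolding D_def by (rule cINF_greatest) (use mono[of h] that in auto)
  have "slope \<midarrow>0\<rightarrow> D"
  proof (rule LIM_I)
    fix e :: real assume e: "e > 0"
    obtain h where h: "h > 0" "s - h > a" "f (s + h) + f (s - h) - 2 * f s \<le> e / 2 * h"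
      using small[of "e / 2"] e by auto
    have "slope h - slope (- h) = (f (s + h) + f (s - h) - 2 * f s) / h"
      using h by (simp add: slope_def field_simps)
    also have "\<dots> \<le> e / 2" using h by (simp add: divide_le_eq)
    finally have close: "slope h - slope (- h) < e" using e by linarith
    show "\<exists>r>0. \<forall>x. x \<noteq> 0 \<and> norm (x - 0) < r \<longrightarrow> norm (slope x - D) < e"
    proof (intro exI[of _ h] conjI allI impI)
      fix x :: real assume x: "x \<noteq> 0 \<and> norm (x - 0) < h"
      have "slope (- h) \<le> slope x" "slope x \<le> slope h"
        using x h by (auto intro!: mono simp: abs_less_iff)
      thus "norm (slope x - D) < e"
        using close D_le[of h] D_ge[of "- h"] h by (simp add: abs_less_iff)
    qed (use h in auto)
  qed
  hence "(f has_field_derivative D) (at s)"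
    unfolding DERIV_def slope_def .
  thus ?thesis by (auto simp: real_differentiable_def)
qed

lemma wsum_ratio_le:
  assumes s: "s > 1" and \<tau>: "\<tau> > 0" and n: "\<tau> / n \<le> (s - 1) / 4" "n > 0"
  defines "B \<equiv> exp (4 * \<tau> * ((pres ((s + 1) / 2) - pres s) / (s - 1)) + s * ln 2)"
  shows "wsum n (s - 2 * (\<tau> / n)) / wsum n s \<le> B"
proof -
  define h where "h = \<tau> / n"
  have h: "h > 0" "h \<le> (s - 1) / 4" using \<tau> n by (auto simp: h_def)
  have gt: "s - 2 * h > 1" using h s by (simp add: field_simps)
  have slope: "(pres s - pres ((s + 1) / 2)) / (s - (s + 1) / 2) \<le>
      (pres s - pres (s - 2 * h)) / (s - (s - 2 * h))"
    using s h by (intro convex_slope_mono[OF convex_on_pres]) (auto simp: field_simps)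
  define c where "c = (pres ((s + 1) / 2) - pres s) / (s - 1)"
  have "(pres s - pres ((s + 1) / 2)) / (s - (s + 1) / 2) = - (2 * c)"
    using s by (simp add: c_def field_simps)
  with slope have "- (2 * c) \<le> (pres s - pres (s - 2 * h)) / (2 * h)"
    by simp
  hence "pres (s - 2 * h) - pres s \<le> 4 * h * c"
    using h by (simp add: pos_le_divide_eq mult_ac)
  hence "n * (pres (s - 2 * h) - pres s) \<le> n * (4 * h * c)"
    by (intro mult_left_mono) auto
  also have "\<dots> = 4 * \<tau> * c"
    using n by (simp add: h_def)
  finally have "n * pres (s - 2 * h) - n * pres s
      \<le> 4 * \<tau> * c"
    by (simp add: right_diff_distrib)
  moreover have "ln (wsum n (s - 2 * h)) \<le> n * pres (s - 2 * h) + s * ln 2"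
  proof -
    have "(s - 2 * h) * ln 2 \<le> s * ln 2" using h by (intro mult_right_mono) auto
    thus ?thesis using pres_ge[OF gt, of n] by linarith
  qed
  moreover have "n * pres s \<le> ln (wsum n s)" by (rule pres_le[OF s])
  ultimately have "ln (wsum n (s - 2 * h)) - ln (wsum n s) \<le>
      4 * \<tau> * c + s * ln 2"
    by linarith
  hence "exp (ln (wsum n (s - 2 * h)) - ln (wsum n s)) \<le> B"
    unfolding B_def exp_le_cancel_iff c_def .
  thus ?thesis using wsum_pos[OF gt, of n] wsum_pos[OF s, of n] by (simp add: exp_diff h_def)
qed

lemma eventually_wsum_mult_le:
  assumes s: "s > 1" and \<tau>: "\<tau> > 0"
  shows "eventually (\<lambda>k. wsum (2 ^ k) (s + \<tau> / 2 ^ k) * wsum (2 ^ k) (s - \<tau> / 2 ^ k)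
    \<le> 2 * (wsum (2 ^ k) s)\<^sup>2) sequentially"
proof -
  define B where "B = exp (4 * \<tau> * ((pres ((s + 1) / 2) - pres s) / (s - 1)) + s * ln 2)"
  have B: "B > 0" by (simp add: B_def)
  have "(\<lambda>k. \<tau> * (1 / 2) ^ k) \<longlonglongrightarrow> \<tau> * 0"
    by (intro tendsto_mult tendsto_const LIMSEQ_power_zero) auto
  hence "eventually (\<lambda>k. \<tau> * (1 / 2) ^ k < (s - 1) / 4) sequentially"
    using s by (intro order_tendstoD) auto
  moreover have "eventually (\<lambda>k. defect s \<tau> (2 ^ k) / (wsum (2 ^ k) s)\<^sup>2 < 1 / B) sequentially"
    using s \<tau> B defect_tendsto_0[of s \<tau>] by (intro order_tendstoD(2)) auto
  ultimately show ?thesis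
  proof eventually_elim
    case (elim k)
    let ?n = "2 ^ k :: nat" and ?h = "\<tau> / 2 ^ k"
    have h: "?h > 0" "?h < (s - 1) / 4"
      using elim(1) \<tau> by (auto simp: power_divide)
    have Z: "wsum ?n s > 0" using wsum_pos s by auto
    have *: "x \<le> 2" if "x - 1 \<le> (y + z) / 2" "y \<le> 1" "z \<le> 1" for x y z :: real
      using that by simp
    have "wsum ?n (s + ?h) * wsum ?n (s - ?h) / (wsum ?n s)\<^sup>2 - 1 \<le>
        (B * (defect s \<tau> ?n / (wsum ?n s)\<^sup>2) + wsum ?n (s - 2 * ?h) / wsum ?n s / B) / 2"
    proof -
      have "\<bar>2 * x\<bar> < s - 1" if "x > 0" "x < (s - 1) / 4" for x :: real
        using that s by (simp add: abs_less_iff)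
      from this[OF h] have "\<bar>2 * ?h\<bar> < s - 1" .
      from wsum_mult_le[OF s this B, of ?n] show ?thesis by (simp add: defect_def)
    qed
    moreover have "B * (defect s \<tau> ?n / (wsum ?n s)\<^sup>2) \<le> 1"
      using elim(2) B by (simp add: pos_less_divide_eq mult.commute)
    moreover have "wsum ?n (s - 2 * ?h) / wsum ?n s \<le> B"
      unfolding B_def using wsum_ratio_le[OF s \<tau>, of ?n] h by simp
    hence "wsum ?n (s - 2 * ?h) / wsum ?n s / B \<le> 1"
      using B by (simp only: divide_le_eq_1_pos)
    ultimately have "wsum ?n (s + ?h) * wsum ?n (s - ?h) / (wsum ?n s)\<^sup>2 \<le> 2"
      by (rule *)
    thus ?case using Z by (simp add: divide_le_eq)
  qed
qed

theorem pres_differentiable: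
  assumes s: "s > 1"
  shows "pres differentiable (at s)"
proof (rule convex_on_has_derivative_second_difference[OF convex_on_pres s])
  fix e :: real assume e: "e > 0"
  define \<tau> where "\<tau> = (2 * s * ln 2 + 1) / e"
  have \<tau>: "\<tau> > 0" using e s by (simp add: \<tau>_def add_pos_pos)
  have "(\<lambda>k. \<tau> * (1 / 2) ^ k) \<longlonglongrightarrow> \<tau> * 0"
    by (intro tendsto_mult tendsto_const LIMSEQ_power_zero) auto
  hence "eventually (\<lambda>k. \<tau> * (1 / 2) ^ k < s - 1) sequentially"
    using s by (intro order_tendstoD) auto
  from eventually_happens'[OF _ eventually_conj[OF this eventually_wsum_mult_le[OF s \<tau>]]]
  obtain k where k: "\<tau> * (1 / 2) ^ k < s - 1" "wsum (2 ^ k) (s + \<tau> / 2 ^ k) *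
    wsum (2 ^ k) (s - \<tau> / 2 ^ k) \<le> 2 * (wsum (2 ^ k) s)\<^sup>2"
    by auto
  define n :: nat where "n = 2 ^ k"
  define h where "h = \<tau> / n"
  have n: "n > 0" by (simp add: n_def)
  have h: "h > 0" "h < s - 1" using k(1) \<tau> by (auto simp: h_def n_def power_divide)
  have gt: "s + h > 1" "s - h > 1" using h s by auto
  note pos = wsum_pos[OF gt(1), of n] wsum_pos[OF gt(2), of n] wsum_pos[OF s, of n]
  have "n * pres (s + h) + n * pres (s - h) \<le> ln (wsum n (s + h)) + ln (wsum n (s - h))"
    by (intro add_mono pres_le gt)
  also have "\<dots> = ln (wsum n (s + h) * wsum n (s - h))"
    using pos by (simp add: ln_mult_pos)
  also have "\<dots> \<le> ln (2 * (wsum n s)\<^sup>2)"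
    using k(2) pos by (subst ln_le_cancel_iff) (auto simp: h_def n_def)
  also have "\<dots> = ln 2 + 2 * ln (wsum n s)"
    using pos by (simp add: ln_mult_pos ln_realpow)
  also have "\<dots> \<le> ln 2 + 2 * (n * pres s + s * ln 2)"
    using pres_ge[OF s, of n] by simp
  also have "\<dots> \<le> 2 * n * pres s + \<tau> * e"
    using e ln_2_less_1 by (simp add: \<tau>_def)
  finally have "n * (pres (s + h) + pres (s - h) - 2 * pres s) \<le> n * (e * h)"
    using n by (simp add: h_def algebra_simps)
  hence "pres (s + h) + pres (s - h) - 2 * pres s \<le> e * h"
    using n by simp
  thus "\<exists>h>0. s - h > 1 \<and> pres (s + h) + pres (s - h) - 2 * pres s \<le> e * h"
    using h gt by blast
qed

section \<open>Asymptotics\<close>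

lemma zeta_at_right_1: "filterlim zeta at_top (at_right 1)"
  unfolding filterlim_at_top_dense
proof
  fix B :: real
  have "eventually (\<lambda>M. harm M > B) sequentially"
    using harm_at_top by (simp add: filterlim_at_top_dense)
  then obtain M :: nat where M: "harm M > B"
    by (auto simp: eventually_sequentially)
  have "((\<lambda>s. \<Sum>k=1..M. real k powr (- s)) \<longlongrightarrow> (\<Sum>k=1..M. real k powr (- 1))) (at_right 1)"
    by (intro tendsto_intros) auto
  moreover have "(\<Sum>k=1..M. real k powr (- 1)) = harm M"
    unfolding harm_def by (intro sum.cong) (auto simp: powr_minus_divide inverse_eq_divide)
  ultimately have "eventually (\<lambda>s. (\<Sum>k=1..M. real k powr (- s)) > B) (at_right 1)"
    using M by (intro order_tendstoD) auto
  moreover have "eventually (\<lambda>s::real. s > 1) (at_right 1)"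
    by (rule eventually_at_right_less)
  ultimately show "eventually (\<lambda>s. zeta s > B) (at_right 1)"
  proof eventually_elim
    case (elim s)
    have "(\<Sum>k=1..M. real k powr (- s)) \<le> zeta s"
      using elim by (intro finite_sum_le_has_sum[OF zeta_has_sum]) auto
    thus ?case using elim by linarith
  qed
qed

lemma
  assumes "s > 1"
  shows pres_le_ln_zeta: "pres s \<le> ln (zeta s)"
    and pres_ge_ln_zeta: "ln (zeta s) - s * ln 2 \<le> pres s"
  using pres_le[OF assms, of 1] pres_ge[OF assms, of 1] wsum_1[OF assms] by auto

lemma pres_at_right_1: "filterlim pres at_top (at_right 1)"
proof (rule filterlim_at_top_mono)
  have "filterlim (\<lambda>s. - (s * ln 2) + ln (zeta s)) at_top (at_right 1)"
  proof (rule filterlim_tendsto_add_at_top)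
    show "((\<lambda>s. - (s * ln 2)) \<longlongrightarrow> - (1 * ln 2)) (at_right (1::real))"
      by (intro tendsto_intros)
    show "filterlim (\<lambda>s. ln (zeta s)) at_top (at_right 1)"
      by (rule filterlim_compose[OF ln_at_top zeta_at_right_1])
  qed
  thus "filterlim (\<lambda>s. ln (zeta s) - s * ln 2) at_top (at_right 1)"
    by simp
  show "eventually (\<lambda>s. ln (zeta s) - s * ln 2 \<le> pres s) (at_right 1)"
    using eventually_at_right_less[of "1::real"] by eventually_elim (rule pres_ge_ln_zeta)
qed

lemma pres_has_derivative:
  "s > 1 \<Longrightarrow> (pres has_field_derivative deriv pres s) (at s)"
  using pres_differentiable DERIV_deriv_iff_real_differentiable by blast

lemma pres_above_tangent:
  assumes "s > 1" "x > 1"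
  shows "deriv pres s * (x - s) \<le> pres x - pres s"
  by (rule convex_on_imp_above_tangent[OF convex_on_pres])
     (use assms in \<open>auto simp: interior_open intro: has_field_derivative_at_within[OF pres_has_derivative]\<close>)

lemma deriv_pres_at_right_1: "filterlim (\<lambda>s. - deriv pres s) at_top (at_right 1)"
proof (rule filterlim_at_top_mono)
  show "filterlim (\<lambda>s. - pres 2 + pres s) at_top (at_right 1)"
    by (intro filterlim_tendsto_add_at_top[OF tendsto_const] pres_at_right_1)
  have "eventually (\<lambda>s. s < (2::real)) (at_right 1)"
    using eventually_at_right_real[of 1 "2::real"] by (auto elim!: eventually_mono)
  moreover have "eventually (\<lambda>s. pres s \<ge> pres 2) (at_right 1)"
    using pres_at_right_1 by (simp add: filterlim_at_top)
  ultimately show "eventually (\<lambda>s. - pres 2 + pres s \<le> - deriv pres s) (at_right 1)"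
    using eventually_at_right_less[of "1::real"]
  proof eventually_elim
    case (elim s)
    have t: "deriv pres s * (2 - s) \<le> pres 2 - pres s"
      using pres_above_tangent[of s 2] elim by simp
    have "deriv pres s \<le> 0"
    proof (rule ccontr)
      assume "\<not> deriv pres s \<le> 0"
      hence "deriv pres s * (2 - s) > 0" using elim by simp
      thus False using t elim by simp
    qed
    hence "deriv pres s * 1 \<le> deriv pres s * (2 - s)"
      using elim by (intro mult_left_mono_neg) auto
    thus ?case using t by simp
  qed
qed

lemma pres_div_at_top: "((\<lambda>s. pres s / s) \<longlongrightarrow> - ln golden) at_top"
proof (rule tendsto_sandwich)
  show "eventually (\<lambda>s. - ln golden \<le> pres s / s) at_top"
    using eventually_gt_at_top[of 1]
    by eventually_elim (use pres_ge_golden in \<open>auto simp: pos_le_divide_eq mult.commute\<close>)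
  show "eventually (\<lambda>s. pres s / s \<le> (pres 2 + 2 * ln golden) * inverse s - ln golden) at_top"
    using eventually_gt_at_top[of 2]
  proof eventually_elim
    case (elim s)
    have "pres s / s \<le> (pres 2 - (s - 2) * ln golden) / s"
      using pres_le_golden[of s] elim by (intro divide_right_mono) auto
    also have "\<dots> = (pres 2 + 2 * ln golden) * inverse s - ln golden"
      using elim by (simp add: field_simps)
    finally show ?case .
  qed
  have "((\<lambda>s. (pres 2 + 2 * ln golden) * inverse s - ln golden) \<longlongrightarrow>
      (pres 2 + 2 * ln golden) * 0 - ln golden) at_top"
    by (intro tendsto_intros tendsto_inverse_0_at_top filterlim_ident)
  thus "((\<lambda>s. (pres 2 + 2 * ln golden) * inverse s - ln golden) \<longlongrightarrow> - ln golden) at_top"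
    by simp
qed auto

lemma deriv_pres_at_top: "(deriv pres \<longlongrightarrow> - ln golden) at_top"
proof (rule tendsto_sandwich)
  have half: "((\<lambda>s. pres (s / 2) / (s / 2)) \<longlongrightarrow> - ln golden) at_top"
    by (rule filterlim_compose[OF pres_div_at_top]) real_asymp
  have double: "((\<lambda>s. pres (2 * s) / (2 * s)) \<longlongrightarrow> - ln golden) at_top"
    by (rule filterlim_compose[OF pres_div_at_top]) real_asymp
  have "((\<lambda>s. 2 * (pres s / s) - pres (s / 2) / (s / 2)) \<longlongrightarrow>
      2 * (- ln golden) - (- ln golden)) at_top"
    by (intro tendsto_intros pres_div_at_top half)
  thus "((\<lambda>s. 2 * (pres s / s) - pres (s / 2) / (s / 2)) \<longlongrightarrow> - ln golden) at_top"
    by simp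
  have "((\<lambda>s. 2 * (pres (2 * s) / (2 * s)) - pres s / s) \<longlongrightarrow>
      2 * (- ln golden) - (- ln golden)) at_top"
    by (intro tendsto_intros pres_div_at_top double)
  thus "((\<lambda>s. 2 * (pres (2 * s) / (2 * s)) - pres s / s) \<longlongrightarrow> - ln golden) at_top"
    by simp
  show "eventually (\<lambda>s. 2 * (pres s / s) - pres (s / 2) / (s / 2) \<le> deriv pres s) at_top"
    using eventually_gt_at_top[of 2]
  proof eventually_elim
    case (elim s)
    thus ?case using pres_above_tangent[of s "s / 2"] by (simp add: field_simps)
  qed
  show "eventually (\<lambda>s. deriv pres s \<le> 2 * (pres (2 * s) / (2 * s)) - pres s / s) at_top"
    using eventually_gt_at_top[of 2]
  proof eventually_elim
    case (elim s)
    thus ?case using pres_above_tangent[of s "2 * s"] by (simp add: field_simps)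
  qed
qed

lemma deriv_P1:
  assumes "2 * (t - q) > 1"
  shows "deriv (\<lambda>q'. P1 t q') q = - 2 * deriv pres (2 * (t - q))"
proof (rule DERIV_imp_deriv)
  have "((\<lambda>q'. pres (2 * (t - q'))) has_field_derivative deriv pres (2 * (t - q)) * (- 2)) (at q)"
    by (rule DERIV_chain2[where f = pres and g = "\<lambda>q'. 2 * (t - q')", OF pres_has_derivative[OF assms]])
       (auto intro!: derivative_eq_intros)
  moreover have "open {q'. 2 * (t - q') > 1}"
    by (intro open_Collect_less continuous_intros)
  ultimately show "((\<lambda>q'. P1 t q') has_field_derivative - 2 * deriv pres (2 * (t - q))) (at q)"
    using assms
    by (auto simp: P1_eq_pres mult.commute
      intro: has_field_derivative_transform_within_open[where S = "{q'. 2 * (t - q') > 1}"])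
qed

lemma filterlim_gap_at_left: "filterlim (\<lambda>q. 2 * (t - q)) (at_right 1) (at_left (t - 1/2 :: real))"
proof -
  have "((\<lambda>q. 2 * (t - q)) \<longlongrightarrow> 2 * (t - (t - 1/2))) (at_left (t - 1/2))"
    by (intro tendsto_intros)
  moreover have "eventually (\<lambda>q. q < t - 1/2) (at_left (t - 1/2))"
    by (simp add: eventually_at_filter)
  ultimately show ?thesis
    by (auto simp: filterlim_at elim!: eventually_mono)
qed

theorem proposition6p1:
  "(\<forall>t q. (t, q) \<in> Dtilde \<longrightarrow>
       - (t - q) * ln 4 + ln (zeta (2 * t - 2 * q)) \<le> P1 t q
       \<and> P1 t q \<le> ln (zeta (2 * t - 2 * q)))
   \<and> (\<forall>t0 q0 :: real. t0 - q0 = 1/2 \<longrightarrow>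
       filterlim (\<lambda>(t, q). P1 t q) at_top (at (t0, q0) within Dtilde))
   \<and> (\<forall>t. filterlim (\<lambda>q. deriv (\<lambda>q'. P1 t q') q) at_top (at_left (t - 1/2)))
   \<and> (\<forall>t. ((\<lambda>q. P1 t q / q) \<longlongrightarrow> gamma0) at_bot)
   \<and> (\<forall>t. ((\<lambda>q. deriv (\<lambda>q'. P1 t q') q) \<longlongrightarrow> gamma0) at_bot)"
proof (intro conjI allI impI)
  fix t q assume "(t, q) \<in> Dtilde"
  hence s: "2 * (t - q) > 1" by (simp add: Dtilde_def)
  have "ln 4 = 2 * ln (2::real)"
    using ln_realpow[of 2 2] by simp
  thus "- (t - q) * ln 4 + ln (zeta (2 * t - 2 * q)) \<le> P1 t q"
    using pres_ge_ln_zeta[OF s] by (simp add: P1_eq_pres[OF s] algebra_simps)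
  show "P1 t q \<le> ln (zeta (2 * t - 2 * q))"
    using pres_le_ln_zeta[OF s] by (simp add: P1_eq_pres[OF s] algebra_simps)
next
  fix t0 q0 :: real assume line: "t0 - q0 = 1/2"
  let ?F = "at (t0, q0) within Dtilde"
  have D: "eventually (\<lambda>p. p \<in> Dtilde) ?F"
    by (simp add: eventually_at_filter)
  have "((\<lambda>p. 2 * (fst p - snd p)) \<longlongrightarrow> 2 * (fst (t0, q0) - snd (t0, q0))) ?F"
    by (intro tendsto_intros)
  hence "filterlim (\<lambda>p. 2 * (fst p - snd p)) (at_right 1) ?F"
    using line D by (auto simp: filterlim_at Dtilde_def elim!: eventually_mono)
  hence "filterlim (\<lambda>p. pres (2 * (fst p - snd p))) at_top ?F"
    by (rule filterlim_compose[OF pres_at_right_1])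
  moreover have "eventually (\<lambda>p. pres (2 * (fst p - snd p)) = (case p of (t, q) \<Rightarrow> P1 t q)) ?F"
    using D by eventually_elim (auto simp: Dtilde_def P1_eq_pres)
  ultimately show "filterlim (\<lambda>(t, q). P1 t q) at_top ?F"
    using filterlim_cong[OF refl refl] by fast
next
  fix t :: real
  have "filterlim (\<lambda>q. 2 * - deriv pres (2 * (t - q))) at_top (at_left (t - 1/2))"
    by (intro filterlim_tendsto_pos_mult_at_top[OF tendsto_const]
        filterlim_compose[OF deriv_pres_at_right_1] filterlim_gap_at_left) auto
  moreover have "eventually (\<lambda>q. q < t - 1/2) (at_left (t - 1/2))"
    by (simp add: eventually_at_filter)
  hence "eventually (\<lambda>q. 2 * - deriv pres (2 * (t - q)) = deriv (\<lambda>q'. P1 t q') q) (at_left (t - 1/2))"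
    by eventually_elim (simp add: deriv_P1)
  ultimately show "filterlim (\<lambda>q. deriv (\<lambda>q'. P1 t q') q) at_top (at_left (t - 1/2))"
    using filterlim_cong[OF refl refl] by fast
next
  fix t :: real
  have gap: "filterlim (\<lambda>q. 2 * (t - q)) at_top at_bot" by real_asymp
  have ratio: "((\<lambda>q. 2 * (t - q) / q) \<longlongrightarrow> - 2) at_bot" by real_asymp
  have dom: "eventually (\<lambda>q. q < min 0 (t - 1/2)) at_bot"
    by (rule eventually_gt_at_bot)
  have g: "gamma0 = - ln golden * - 2" "gamma0 = - 2 * - ln golden"
    by (simp_all add: gamma0_def golden_def)
  have "((\<lambda>q. pres (2 * (t - q)) / (2 * (t - q)) * (2 * (t - q) / q)) \<longlongrightarrow> gamma0) at_bot"
    unfolding g(1) by (intro tendsto_mult ratio filterlim_compose[OF pres_div_at_top gap])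
  moreover have "eventually (\<lambda>q. pres (2 * (t - q)) / (2 * (t - q)) * (2 * (t - q) / q) = P1 t q / q) at_bot"
    using dom by eventually_elim (simp add: P1_eq_pres)
  ultimately show "((\<lambda>q. P1 t q / q) \<longlongrightarrow> gamma0) at_bot"
    using filterlim_cong[OF refl refl] by fast
  have "((\<lambda>q. - 2 * deriv pres (2 * (t - q))) \<longlongrightarrow> gamma0) at_bot"
    unfolding g(2) by (intro tendsto_mult tendsto_const filterlim_compose[OF deriv_pres_at_top gap])
  moreover have "eventually (\<lambda>q. - 2 * deriv pres (2 * (t - q)) = deriv (\<lambda>q'. P1 t q') q) at_bot"
    using dom by eventually_elim (simp add: deriv_P1)
  ultimately show "((\<lambda>q. deriv (\<lambda>q'. P1 t q') q) \<longlongrightarrow> gamma0) at_bot"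
    using filterlim_cong[OF refl refl] by fast
qed

end
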